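(* Let $\mathsf{S},\mathsf{A},\mathsf{B}$ be three categories such that $\mathsf{B}$ has finite colimits and $\mathsf{A},\mathsf{S}$ have finite limits, and let $\mathcal{T}=\{\circledcirc,\ \langle -,-|,\ |-,-\rangle\}$ be a THC situation on them. Then the Leibniz operations $\odot$, $\langle\!\langle -,-|\!|$, $|\!|-,-\rangle\!\rangle$ associated with $\mathcal{T}$ form another THC situation (denoted $\mathcal{T}^{[1]}$) on the functor categories $\mathsf{S}^{[1]},\mathsf{A}^{[1]},\mathsf{B}^{[1]}$. In other words, for $f\in\mathsf{A}^{[1]}$, $u\in\mathsf{S}^{[1]}$, $g\in\mathsf{B}^{[1]}$ there are isomorphisms, natural in each component with respect to morphisms in the functor categories, $$\mathsf{B}^{[1]}(f\odot u,\, g)\;\cong\;\mathsf{A}^{[1]}(f,\ \langle\!\langle u,g|\!|)\;\cong\;\mathsf{S}^{[1]}(u,\ |\!|f,g\rangle\!\rangle),$$ induced by the functors $\circledcirc$, $\langle -,-|$, $|-,-\rangle$ of $\mathcal{T}$.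
   Context: For a category $\mathsf{C}$, $\mathsf{C}(X,Y)$ denotes its hom-set and $\mathsf{C}^{[1]}$ denotes its arrow category: objects are morphisms of $\mathsf{C}$, morphisms are commutative squares. THC situation (also called an adjunction of two variables): given categories $\mathsf{S},\mathsf{A},\mathsf{B}$, a THC situation $\mathcal{T}$ is a triple of functors $$\circledcirc:\mathsf{A}\times\mathsf{S}\to\mathsf{B},\qquad \langle -,-|:\mathsf{S}^{\mathrm{op}}\times\mathsf{B}\to\mathsf{A},\qquad |-,-\rangle:\mathsf{A}^{\mathrm{op}}\times\mathsf{B}\to\mathsf{S}$$ together with isomorphisms, natural in each of $A\in\mathsf{A}$, $B\in\mathsf{B}$, $S\in\mathsf{S}$, $$\mathsf{B}(A\circledcirc S,B)\cong\mathsf{A}(A,\langle S,B|)\cong\mathsf{S}(S,|A,B\rangle).$$ Leibniz operations: suppose $\mathsf{B}$ has finite colimits and $\mathsf{A},\mathsf{S}$ have finite limits. The Leibniz operations are the functors $$\odot:\mathsf{A}^{[1]}\times\mathsf{S}^{[1]}\to\mathsf{B}^{[1]},\qquad \langle\!\langle -,-|\!|:(\mathsf{S}^{[1]})^{\mathrm{op}}\times\mathsf{B}^{[1]}\to\mathsf{A}^{[1]},\qquad |\!|-,-\rangle\!\rangle:(\mathsf{A}^{[1]})^{\mathrm{op}}\times\mathsf{B}^{[1]}\to\mathsf{S}^{[1]}$$ defined, for $f:A\to B$ in $\mathsf{A}$, $u:L\to K$ in $\mathsf{S}$, $g:X\to Y$ in $\mathsf{B}$, as follows. - $f\odot u: (B\circledcirc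 L)\amalg_{A\circledcirc L}(A\circledcirc K)\to B\circledcirc K$ is the arrow out of the pushout of $f\circledcirc L$ and $A\circledcirc u$ induced by $B\circledcirc u$ and $f\circledcirc K$. - $\langle\!\langle u,g|\!|: \langle K,X|\to \langle L,X|\times_{\langle L,Y|}\langle K,Y|$ is the arrow into the pullback of $\langle L,g|$ and $\langle u,Y|$ induced by $\langle u,X|$ and $\langle K,g|$. - $|\!|f,g\rangle\!\rangle: |B,X\rangle\to |A,X\rangle\times_{|A,Y\rangle}|B,Y\rangle$ is the arrow into the pullback of $|A,g\rangle$ and $|f,Y\rangle$ induced by $|f,X\rangle$ and $|B,g\rangle$. *)

theory Defs
  imports Main
begin

section \<open>Categories and functors\<close>

text \<open>A category is carried by sets of objects and arrows inside HOL types; the values of the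
  operations outside these carriers are irrelevant. \<open>g \<cdot>\<^bsub>C\<^esub> f\<close> is ``\<open>g\<close> after \<open>f\<close>''.\<close>

record ('o, 'm) cat =
  Obj :: "'o set"
  Arr :: "'m set"
  Dom :: "'m \<Rightarrow> 'o"
  Cod :: "'m \<Rightarrow> 'o"
  Ident :: "'o \<Rightarrow> 'm"
  Comp :: "'m \<Rightarrow> 'm \<Rightarrow> 'm"  (infixr "\<cdot>\<index>" 70)

definition hom :: "('o, 'm) cat \<Rightarrow> 'o \<Rightarrow> 'o \<Rightarrow> 'm set" where
  "hom C X Y = {f \<in> Arr C. Dom C f = X \<and> Cod C f = Y}"

locale category =
  fixes C :: "('o, 'm) cat"
  assumes dom_obj: "f \<in> Arr C \<Longrightarrow> Dom C f \<in> Obj C"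
    and cod_obj: "f \<in> Arr C \<Longrightarrow> Cod C f \<in> Obj C"
    and ident_hom: "X \<in> Obj C \<Longrightarrow> Ident C X \<in> hom C X X"
    and comp_hom: "\<lbrakk>f \<in> hom C X Y; g \<in> hom C Y Z\<rbrakk> \<Longrightarrow> g \<cdot>\<^bsub>C\<^esub> f \<in> hom C X Z"
    and ident_left: "f \<in> hom C X Y \<Longrightarrow> Ident C Y \<cdot>\<^bsub>C\<^esub> f = f"
    and ident_right: "f \<in> hom C X Y \<Longrightarrow> f \<cdot>\<^bsub>C\<^esub> Ident C X = f"
    and assoc: "\<lbrakk>f \<in> hom C W X; g \<in> hom C X Y; h \<in> hom C Y Z\<rbrakk>
      \<Longrightarrow> (h \<cdot>\<^bsub>C\<^esub> g) \<cdot>\<^bsub>C\<^esub> f = h \<cdot>\<^bsub>C\<^esub> (g \<cdot>\<^bsub>C\<^esub> f)"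

definition op_cat :: "('o, 'm) cat \<Rightarrow> ('o, 'm) cat" where
  "op_cat C = \<lparr>Obj = Obj C, Arr = Arr C, Dom = Cod C, Cod = Dom C, Ident = Ident C,
     Comp = (\<lambda>g f. f \<cdot>\<^bsub>C\<^esub> g)\<rparr>"

definition prod_cat :: "('o, 'm) cat \<Rightarrow> ('p, 'n) cat \<Rightarrow> ('o \<times> 'p, 'm \<times> 'n) cat" where
  "prod_cat C D = \<lparr>Obj = Obj C \<times> Obj D, Arr = Arr C \<times> Arr D,
     Dom = map_prod (Dom C) (Dom D), Cod = map_prod (Cod C) (Cod D),
     Ident = map_prod (Ident C) (Ident D),
     Comp = (\<lambda>g f. (fst g \<cdot>\<^bsub>C\<^esub> fst f, snd g \<cdot>\<^bsub>D\<^esub> snd f))\<rparr>"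

record ('o, 'm, 'p, 'n) cfunctor =
  omap :: "'o \<Rightarrow> 'p"
  amap :: "'m \<Rightarrow> 'n"

definition is_functor :: "('o, 'm) cat \<Rightarrow> ('p, 'n) cat \<Rightarrow> ('o, 'm, 'p, 'n) cfunctor \<Rightarrow> bool" where
  "is_functor C D F \<longleftrightarrow>
     (\<forall>X \<in> Obj C. omap F X \<in> Obj D) \<and>
     (\<forall>f \<in> Arr C. amap F f \<in> hom D (omap F (Dom C f)) (omap F (Cod C f))) \<and>
     (\<forall>X \<in> Obj C. amap F (Ident C X) = Ident D (omap F X)) \<and>
     (\<forall>f \<in> Arr C. \<forall>g \<in> Arr C. Cod C f = Dom C g \<longrightarrow>
        amap F (g \<cdot>\<^bsub>C\<^esub> f) = amap F g \<cdot>\<^bsub>D\<^esub> amap F f)"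


section \<open>The arrow category\<close>

text \<open>\<open>Square f g a b\<close> is the square from \<open>f\<close> to \<open>g\<close> with \<open>a\<close> between the domains and \<open>b\<close>
  between the codomains.\<close>

datatype 'm square = Square (sq_src: 'm) (sq_tgt: 'm) (sq_top: 'm) (sq_bot: 'm)

definition arrow_cat :: "('o, 'm) cat \<Rightarrow> ('m, 'm square) cat" where
  "arrow_cat C = \<lparr>
     Obj = Arr C,
     Arr = {Square f g a b | f g a b.
        f \<in> Arr C \<and> g \<in> Arr C \<and> a \<in> hom C (Dom C f) (Dom C g) \<and> b \<in> hom C (Cod C f) (Cod C g) \<and>
        g \<cdot>\<^bsub>C\<^esub> a = b \<cdot>\<^bsub>C\<^esub> f},
     Dom = sq_src,
     Cod = sq_tgt,
     Ident = (\<lambda>f. Square f f (Ident C (Dom C f)) (Ident C (Cod C f))),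
     Comp = (\<lambda>\<tau> \<sigma>. Square (sq_src \<sigma>) (sq_tgt \<tau>)
        (sq_top \<tau> \<cdot>\<^bsub>C\<^esub> sq_top \<sigma>) (sq_bot \<tau> \<cdot>\<^bsub>C\<^esub> sq_bot \<sigma>))\<rparr>"


section \<open>Finite limits and colimits\<close>

definition is_cone ::
  "('j, 'k) cat \<Rightarrow> ('o, 'm) cat \<Rightarrow> ('j, 'k, 'o, 'm) cfunctor \<Rightarrow> 'o \<Rightarrow> ('j \<Rightarrow> 'm) \<Rightarrow> bool" where
  "is_cone J C F N p \<longleftrightarrow> N \<in> Obj C \<and> (\<forall>j \<in> Obj J. p j \<in> hom C N (omap F j)) \<and>
     (\<forall>u \<in> Arr J. amap F u \<cdot>\<^bsub>C\<^esub> p (Dom J u) = p (Cod J u))"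

definition is_limit ::
  "('j, 'k) cat \<Rightarrow> ('o, 'm) cat \<Rightarrow> ('j, 'k, 'o, 'm) cfunctor \<Rightarrow> 'o \<Rightarrow> ('j \<Rightarrow> 'm) \<Rightarrow> bool" where
  "is_limit J C F N p \<longleftrightarrow> is_cone J C F N p \<and>
     (\<forall>N' p'. is_cone J C F N' p' \<longrightarrow>
        (\<exists>!h. h \<in> hom C N' N \<and> (\<forall>j \<in> Obj J. p j \<cdot>\<^bsub>C\<^esub> h = p' j)))"

definition is_cocone ::
  "('j, 'k) cat \<Rightarrow> ('o, 'm) cat \<Rightarrow> ('j, 'k, 'o, 'm) cfunctor \<Rightarrow> 'o \<Rightarrow> ('j \<Rightarrow> 'm) \<Rightarrow> bool" where
  "is_cocone J C F N i \<longleftrightarrow> N \<in> Obj C \<and> (\<forall>j \<in> Obj J. i j \<in> hom C (omap F j) N) \<and>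
     (\<forall>u \<in> Arr J. i (Cod J u) \<cdot>\<^bsub>C\<^esub> amap F u = i (Dom J u))"

definition is_colimit ::
  "('j, 'k) cat \<Rightarrow> ('o, 'm) cat \<Rightarrow> ('j, 'k, 'o, 'm) cfunctor \<Rightarrow> 'o \<Rightarrow> ('j \<Rightarrow> 'm) \<Rightarrow> bool" where
  "is_colimit J C F N i \<longleftrightarrow> is_cocone J C F N i \<and>
     (\<forall>N' i'. is_cocone J C F N' i' \<longrightarrow>
        (\<exists>!h. h \<in> hom C N N' \<and> (\<forall>j \<in> Obj J. h \<cdot>\<^bsub>C\<^esub> i j = i' j)))"

text \<open>Index categories with objects and arrows in \<open>nat\<close> suffice: every finite category is
  isomorphic to one of these. Finitely many arrows force finitely many objects.\<close>

definition has_finite_limits :: "('o, 'm) cat \<Rightarrow> bool" where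
  "has_finite_limits C \<longleftrightarrow> (\<forall>(J :: (nat, nat) cat) F.
     category J \<and> finite (Arr J) \<and> is_functor J C F \<longrightarrow> (\<exists>N p. is_limit J C F N p))"

definition has_finite_colimits :: "('o, 'm) cat \<Rightarrow> bool" where
  "has_finite_colimits C \<longleftrightarrow> (\<forall>(J :: (nat, nat) cat) F.
     category J \<and> finite (Arr J) \<and> is_functor J C F \<longrightarrow> (\<exists>N i. is_colimit J C F N i))"


section \<open>Chosen pullbacks and pushouts\<close>

definition is_pullback :: "('o, 'm) cat \<Rightarrow> 'm \<Rightarrow> 'm \<Rightarrow> 'm \<Rightarrow> 'm \<Rightarrow> bool" where
  "is_pullback C f g p q \<longleftrightarrow>
     f \<in> Arr C \<and> g \<in> Arr C \<and> Cod C f = Cod C g \<and>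
     p \<in> hom C (Dom C p) (Dom C f) \<and> q \<in> hom C (Dom C p) (Dom C g) \<and>
     f \<cdot>\<^bsub>C\<^esub> p = g \<cdot>\<^bsub>C\<^esub> q \<and>
     (\<forall>W x y. x \<in> hom C W (Dom C f) \<and> y \<in> hom C W (Dom C g) \<and> f \<cdot>\<^bsub>C\<^esub> x = g \<cdot>\<^bsub>C\<^esub> y \<longrightarrow>
        (\<exists>!h. h \<in> hom C W (Dom C p) \<and> p \<cdot>\<^bsub>C\<^esub> h = x \<and> q \<cdot>\<^bsub>C\<^esub> h = y))"

definition is_pushout :: "('o, 'm) cat \<Rightarrow> 'm \<Rightarrow> 'm \<Rightarrow> 'm \<Rightarrow> 'm \<Rightarrow> bool" where
  "is_pushout C f g i j \<longleftrightarrow>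
     f \<in> Arr C \<and> g \<in> Arr C \<and> Dom C f = Dom C g \<and>
     i \<in> hom C (Cod C f) (Cod C i) \<and> j \<in> hom C (Cod C g) (Cod C i) \<and>
     i \<cdot>\<^bsub>C\<^esub> f = j \<cdot>\<^bsub>C\<^esub> g \<and>
     (\<forall>W x y. x \<in> hom C (Cod C f) W \<and> y \<in> hom C (Cod C g) W \<and> x \<cdot>\<^bsub>C\<^esub> f = y \<cdot>\<^bsub>C\<^esub> g \<longrightarrow>
        (\<exists>!h. h \<in> hom C (Cod C i) W \<and> h \<cdot>\<^bsub>C\<^esub> i = x \<and> h \<cdot>\<^bsub>C\<^esub> j = y))"

text \<open>The legs of an arbitrary, but fixed, choice of pullbacks and pushouts. The first leg belongs
  to the first arrow of the cospan (span). \<open>pb_pair\<close> and \<open>po_copair\<close> are the induced arrows.\<close>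

definition pullback :: "('o, 'm) cat \<Rightarrow> 'm \<Rightarrow> 'm \<Rightarrow> 'm \<times> 'm" where
  "pullback C f g = (SOME pq. is_pullback C f g (fst pq) (snd pq))"

definition pb1 :: "('o, 'm) cat \<Rightarrow> 'm \<Rightarrow> 'm \<Rightarrow> 'm" where
  "pb1 C f g = fst (pullback C f g)"

definition pb2 :: "('o, 'm) cat \<Rightarrow> 'm \<Rightarrow> 'm \<Rightarrow> 'm" where
  "pb2 C f g = snd (pullback C f g)"

definition pb_pair :: "('o, 'm) cat \<Rightarrow> 'm \<Rightarrow> 'm \<Rightarrow> 'm \<Rightarrow> 'm \<Rightarrow> 'm" where
  "pb_pair C f g x y = (THE h. h \<in> hom C (Dom C x) (Dom C (pb1 C f g)) \<and>
     pb1 C f g \<cdot>\<^bsub>C\<^esub> h = x \<and> pb2 C f g \<cdot>\<^bsub>C\<^esub> h = y)"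

definition pushout :: "('o, 'm) cat \<Rightarrow> 'm \<Rightarrow> 'm \<Rightarrow> 'm \<times> 'm" where
  "pushout C f g = (SOME ij. is_pushout C f g (fst ij) (snd ij))"

definition po1 :: "('o, 'm) cat \<Rightarrow> 'm \<Rightarrow> 'm \<Rightarrow> 'm" where
  "po1 C f g = fst (pushout C f g)"

definition po2 :: "('o, 'm) cat \<Rightarrow> 'm \<Rightarrow> 'm \<Rightarrow> 'm" where
  "po2 C f g = snd (pushout C f g)"

definition po_copair :: "('o, 'm) cat \<Rightarrow> 'm \<Rightarrow> 'm \<Rightarrow> 'm \<Rightarrow> 'm \<Rightarrow> 'm" where
  "po_copair C f g x y = (THE h. h \<in> hom C (Cod C (po1 C f g)) (Cod C x) \<and>
     h \<cdot>\<^bsub>C\<^esub> po1 C f g = x \<and> h \<cdot>\<^bsub>C\<^esub> po2 C f g = y)"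


section \<open>THC situations\<close>

text \<open>\<open>tensor\<close>, \<open>lhom\<close> and \<open>rhom\<close> are \<open>A \<circledcirc> S\<close>, \<open>\<langle>S,B|\<close> and \<open>|A,B\<rangle>\<close>;
  \<open>phi T X Z Y\<close> is the component \<open>B(X \<circledcirc> Z, Y) \<rightarrow> A(X, \<langle>Z,Y|)\<close> and
  \<open>psi T X Z Y\<close> the component \<open>A(X, \<langle>Z,Y|) \<rightarrow> S(Z, |X,Y\<rangle>)\<close> of the structure isomorphisms.\<close>

record ('so, 'sm, 'ao, 'am, 'bo, 'bm) thc =
  tensor :: "('ao \<times> 'so, 'am \<times> 'sm, 'bo, 'bm) cfunctor"
  lhom :: "('so \<times> 'bo, 'sm \<times> 'bm, 'ao, 'am) cfunctor"
  rhom :: "('ao \<times> 'bo, 'am \<times> 'bm, 'so, 'sm) cfunctor"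
  phi :: "'ao \<Rightarrow> 'so \<Rightarrow> 'bo \<Rightarrow> 'bm \<Rightarrow> 'am"
  psi :: "'ao \<Rightarrow> 'so \<Rightarrow> 'bo \<Rightarrow> 'am \<Rightarrow> 'sm"

locale thc_situation =
  S: category S + A: category A + B: category B
  for S :: "('so, 'sm) cat" and A :: "('ao, 'am) cat" and B :: "('bo, 'bm) cat" +
  fixes T :: "('so, 'sm, 'ao, 'am, 'bo, 'bm) thc"
  assumes tensor_functor: "is_functor (prod_cat A S) B (tensor T)"
    and lhom_functor: "is_functor (prod_cat (op_cat S) B) A (lhom T)"
    and rhom_functor: "is_functor (prod_cat (op_cat A) B) S (rhom T)"
    and phi_bij: "\<lbrakk>X \<in> Obj A; Z \<in> Obj S; Y \<in> Obj B\<rbrakk> \<Longrightarrow>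
      bij_betw (phi T X Z Y) (hom B (omap (tensor T) (X, Z)) Y) (hom A X (omap (lhom T) (Z, Y)))"
    and phi_natural_A: "\<lbrakk>a \<in> hom A X' X; X' \<in> Obj A; X \<in> Obj A; Z \<in> Obj S; Y \<in> Obj B;
        h \<in> hom B (omap (tensor T) (X, Z)) Y\<rbrakk> \<Longrightarrow>
      phi T X' Z Y (h \<cdot>\<^bsub>B\<^esub> amap (tensor T) (a, Ident S Z)) = phi T X Z Y h \<cdot>\<^bsub>A\<^esub> a"
    and phi_natural_S: "\<lbrakk>s \<in> hom S Z' Z; X \<in> Obj A; Z' \<in> Obj S; Z \<in> Obj S; Y \<in> Obj B;
        h \<in> hom B (omap (tensor T) (X, Z)) Y\<rbrakk> \<Longrightarrow>
      phi T X Z' Y (h \<cdot>\<^bsub>B\<^esub> amap (tensor T) (Ident A X, s)) =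
        amap (lhom T) (s, Ident B Y) \<cdot>\<^bsub>A\<^esub> phi T X Z Y h"
    and phi_natural_B: "\<lbrakk>b \<in> hom B Y Y'; X \<in> Obj A; Z \<in> Obj S; Y \<in> Obj B; Y' \<in> Obj B;
        h \<in> hom B (omap (tensor T) (X, Z)) Y\<rbrakk> \<Longrightarrow>
      phi T X Z Y' (b \<cdot>\<^bsub>B\<^esub> h) = amap (lhom T) (Ident S Z, b) \<cdot>\<^bsub>A\<^esub> phi T X Z Y h"
    and psi_bij: "\<lbrakk>X \<in> Obj A; Z \<in> Obj S; Y \<in> Obj B\<rbrakk> \<Longrightarrow>
      bij_betw (psi T X Z Y) (hom A X (omap (lhom T) (Z, Y))) (hom S Z (omap (rhom T) (X, Y)))"
    and psi_natural_A: "\<lbrakk>a \<in> hom A X' X; X' \<in> Obj A; X \<in> Obj A; Z \<in> Obj S; Y \<in> Obj B;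
        k \<in> hom A X (omap (lhom T) (Z, Y))\<rbrakk> \<Longrightarrow>
      psi T X' Z Y (k \<cdot>\<^bsub>A\<^esub> a) = amap (rhom T) (a, Ident B Y) \<cdot>\<^bsub>S\<^esub> psi T X Z Y k"
    and psi_natural_S: "\<lbrakk>s \<in> hom S Z' Z; X \<in> Obj A; Z' \<in> Obj S; Z \<in> Obj S; Y \<in> Obj B;
        k \<in> hom A X (omap (lhom T) (Z, Y))\<rbrakk> \<Longrightarrow>
      psi T X Z' Y (amap (lhom T) (s, Ident B Y) \<cdot>\<^bsub>A\<^esub> k) = psi T X Z Y k \<cdot>\<^bsub>S\<^esub> s"
    and psi_natural_B: "\<lbrakk>b \<in> hom B Y Y'; X \<in> Obj A; Z \<in> Obj S; Y \<in> Obj B; Y' \<in> Obj B;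
        k \<in> hom A X (omap (lhom T) (Z, Y))\<rbrakk> \<Longrightarrow>
      psi T X Z Y' (amap (lhom T) (Ident S Z, b) \<cdot>\<^bsub>A\<^esub> k) =
        amap (rhom T) (Ident A X, b) \<cdot>\<^bsub>S\<^esub> psi T X Z Y k"


section \<open>The Leibniz operations\<close>

text \<open>Throughout, \<open>f : Dom f \<rightarrow> Cod f\<close> is an arrow of \<open>A\<close>, \<open>u\<close> of \<open>S\<close>, \<open>g\<close> of \<open>B\<close>. The span (cospan)
  underlying the corner of each Leibniz operation is given by its two arrows, in the order in
  which the operation is written.\<close>

subsection \<open>\<open>f \<odot> u\<close>\<close>

definition tensor_span1 where
  "tensor_span1 S T f u = amap (tensor T) (f, Ident S (Dom S u))"

definition tensor_span2 where
  "tensor_span2 A T f u = amap (tensor T) (Ident A (Dom A f), u)"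

definition tensor_in1 where
  "tensor_in1 S A B T f u = po1 B (tensor_span1 S T f u) (tensor_span2 A T f u)"

definition tensor_in2 where
  "tensor_in2 S A B T f u = po2 B (tensor_span1 S T f u) (tensor_span2 A T f u)"

definition tensor_copair where
  "tensor_copair S A B T f u x y = po_copair B (tensor_span1 S T f u) (tensor_span2 A T f u) x y"

definition leibniz_tensor_obj where
  "leibniz_tensor_obj S A B T f u = tensor_copair S A B T f u
     (amap (tensor T) (Ident A (Cod A f), u)) (amap (tensor T) (f, Ident S (Cod S u)))"

definition leibniz_tensor ::
  "('so, 'sm) cat \<Rightarrow> ('ao, 'am) cat \<Rightarrow> ('bo, 'bm) cat \<Rightarrow> ('so, 'sm, 'ao, 'am, 'bo, 'bm) thc \<Rightarrow>
   ('am \<times> 'sm, 'am square \<times> 'sm square, 'bm, 'bm square) cfunctor" where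
  "leibniz_tensor S A B T = \<lparr>
     omap = (\<lambda>(f, u). leibniz_tensor_obj S A B T f u),
     amap = (\<lambda>(\<sigma>, \<tau>). let f = sq_src \<sigma>; f' = sq_tgt \<sigma>; u = sq_src \<tau>; u' = sq_tgt \<tau> in
       Square (leibniz_tensor_obj S A B T f u) (leibniz_tensor_obj S A B T f' u')
         (tensor_copair S A B T f u
            (tensor_in1 S A B T f' u' \<cdot>\<^bsub>B\<^esub> amap (tensor T) (sq_bot \<sigma>, sq_top \<tau>))
            (tensor_in2 S A B T f' u' \<cdot>\<^bsub>B\<^esub> amap (tensor T) (sq_top \<sigma>, sq_bot \<tau>)))
         (amap (tensor T) (sq_bot \<sigma>, sq_bot \<tau>)))\<rparr>"

subsection \<open>\<open>\<langle>\<langle>u,g||\<close>\<close>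

definition lhom_cospan1 where
  "lhom_cospan1 S T u g = amap (lhom T) (Ident S (Dom S u), g)"

definition lhom_cospan2 where
  "lhom_cospan2 B T u g = amap (lhom T) (u, Ident B (Cod B g))"

definition lhom_pr1 where
  "lhom_pr1 S A B T u g = pb1 A (lhom_cospan1 S T u g) (lhom_cospan2 B T u g)"

definition lhom_pr2 where
  "lhom_pr2 S A B T u g = pb2 A (lhom_cospan1 S T u g) (lhom_cospan2 B T u g)"

definition lhom_pair where
  "lhom_pair S A B T u g x y = pb_pair A (lhom_cospan1 S T u g) (lhom_cospan2 B T u g) x y"

definition leibniz_lhom_obj where
  "leibniz_lhom_obj S A B T u g = lhom_pair S A B T u g
     (amap (lhom T) (u, Ident B (Dom B g))) (amap (lhom T) (Ident S (Cod S u), g))"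

text \<open>On morphisms the first argument is contravariant: a square \<open>\<tau>\<close> from \<open>u'\<close> to \<open>u\<close> and a square
  \<open>\<rho>\<close> from \<open>g\<close> to \<open>g'\<close> give a square from \<open>\<langle>\<langle>u,g||\<close> to \<open>\<langle>\<langle>u',g'||\<close>; likewise for \<open>||f,g\<rangle>\<rangle>\<close>.\<close>

definition leibniz_lhom ::
  "('so, 'sm) cat \<Rightarrow> ('ao, 'am) cat \<Rightarrow> ('bo, 'bm) cat \<Rightarrow> ('so, 'sm, 'ao, 'am, 'bo, 'bm) thc \<Rightarrow>
   ('sm \<times> 'bm, 'sm square \<times> 'bm square, 'am, 'am square) cfunctor" where
  "leibniz_lhom S A B T = \<lparr>
     omap = (\<lambda>(u, g). leibniz_lhom_obj S A B T u g),
     amap = (\<lambda>(\<tau>, \<rho>). let u = sq_tgt \<tau>; u' = sq_src \<tau>; g = sq_src \<rho>; g' = sq_tgt \<rho> in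
       Square (leibniz_lhom_obj S A B T u g) (leibniz_lhom_obj S A B T u' g')
         (amap (lhom T) (sq_bot \<tau>, sq_top \<rho>))
         (lhom_pair S A B T u' g'
            (amap (lhom T) (sq_top \<tau>, sq_top \<rho>) \<cdot>\<^bsub>A\<^esub> lhom_pr1 S A B T u g)
            (amap (lhom T) (sq_bot \<tau>, sq_bot \<rho>) \<cdot>\<^bsub>A\<^esub> lhom_pr2 S A B T u g)))\<rparr>"

subsection \<open>\<open>||f,g\<rangle>\<rangle>\<close>\<close>

definition rhom_cospan1 where
  "rhom_cospan1 A T f g = amap (rhom T) (Ident A (Dom A f), g)"

definition rhom_cospan2 where
  "rhom_cospan2 B T f g = amap (rhom T) (f, Ident B (Cod B g))"

definition rhom_pr1 where
  "rhom_pr1 S A B T f g = pb1 S (rhom_cospan1 A T f g) (rhom_cospan2 B T f g)"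

definition rhom_pr2 where
  "rhom_pr2 S A B T f g = pb2 S (rhom_cospan1 A T f g) (rhom_cospan2 B T f g)"

definition rhom_pair where
  "rhom_pair S A B T f g x y = pb_pair S (rhom_cospan1 A T f g) (rhom_cospan2 B T f g) x y"

definition leibniz_rhom_obj where
  "leibniz_rhom_obj S A B T f g = rhom_pair S A B T f g
     (amap (rhom T) (f, Ident B (Dom B g))) (amap (rhom T) (Ident A (Cod A f), g))"

definition leibniz_rhom ::
  "('so, 'sm) cat \<Rightarrow> ('ao, 'am) cat \<Rightarrow> ('bo, 'bm) cat \<Rightarrow> ('so, 'sm, 'ao, 'am, 'bo, 'bm) thc \<Rightarrow>
   ('am \<times> 'bm, 'am square \<times> 'bm square, 'sm, 'sm square) cfunctor" where
  "leibniz_rhom S A B T = \<lparr>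
     omap = (\<lambda>(f, g). leibniz_rhom_obj S A B T f g),
     amap = (\<lambda>(\<sigma>, \<rho>). let f = sq_tgt \<sigma>; f' = sq_src \<sigma>; g = sq_src \<rho>; g' = sq_tgt \<rho> in
       Square (leibniz_rhom_obj S A B T f g) (leibniz_rhom_obj S A B T f' g')
         (amap (rhom T) (sq_bot \<sigma>, sq_top \<rho>))
         (rhom_pair S A B T f' g'
            (amap (rhom T) (sq_top \<sigma>, sq_top \<rho>) \<cdot>\<^bsub>S\<^esub> rhom_pr1 S A B T f g)
            (amap (rhom T) (sq_bot \<sigma>, sq_bot \<rho>) \<cdot>\<^bsub>S\<^esub> rhom_pr2 S A B T f g)))\<rparr>"

subsection \<open>The induced isomorphisms\<close>

text \<open>For \<open>f : A \<rightarrow> B\<close>, \<open>u : L \<rightarrow> K\<close>, \<open>g : X \<rightarrow> Y\<close>, a square from \<open>f \<odot> u\<close> to \<open>g\<close> consists of compatible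
  arrows \<open>B \<circledcirc> L \<rightarrow> X\<close>, \<open>A \<circledcirc> K \<rightarrow> X\<close> and \<open>B \<circledcirc> K \<rightarrow> Y\<close>; its image consists of their transposes
  \<open>B \<rightarrow> \<langle>L,X|\<close>, \<open>A \<rightarrow> \<langle>K,X|\<close> and \<open>B \<rightarrow> \<langle>K,Y|\<close>, and similarly for the second isomorphism.\<close>

definition leibniz_phi ::
  "('so, 'sm) cat \<Rightarrow> ('ao, 'am) cat \<Rightarrow> ('bo, 'bm) cat \<Rightarrow> ('so, 'sm, 'ao, 'am, 'bo, 'bm) thc \<Rightarrow>
   'am \<Rightarrow> 'sm \<Rightarrow> 'bm \<Rightarrow> 'bm square \<Rightarrow> 'am square" where
  "leibniz_phi S A B T f u g h = Square f (leibniz_lhom_obj S A B T u g)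
     (phi T (Dom A f) (Cod S u) (Dom B g) (sq_top h \<cdot>\<^bsub>B\<^esub> tensor_in2 S A B T f u))
     (lhom_pair S A B T u g
        (phi T (Cod A f) (Dom S u) (Dom B g) (sq_top h \<cdot>\<^bsub>B\<^esub> tensor_in1 S A B T f u))
        (phi T (Cod A f) (Cod S u) (Cod B g) (sq_bot h)))"

definition leibniz_psi ::
  "('so, 'sm) cat \<Rightarrow> ('ao, 'am) cat \<Rightarrow> ('bo, 'bm) cat \<Rightarrow> ('so, 'sm, 'ao, 'am, 'bo, 'bm) thc \<Rightarrow>
   'am \<Rightarrow> 'sm \<Rightarrow> 'bm \<Rightarrow> 'am square \<Rightarrow> 'sm square" where
  "leibniz_psi S A B T f u g k = Square u (leibniz_rhom_obj S A B T f g)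
     (psi T (Cod A f) (Dom S u) (Dom B g) (lhom_pr1 S A B T u g \<cdot>\<^bsub>A\<^esub> sq_bot k))
     (rhom_pair S A B T f g
        (psi T (Dom A f) (Cod S u) (Dom B g) (sq_top k))
        (psi T (Cod A f) (Cod S u) (Cod B g) (lhom_pr2 S A B T u g \<cdot>\<^bsub>A\<^esub> sq_bot k)))"

definition leibniz_thc ::
  "('so, 'sm) cat \<Rightarrow> ('ao, 'am) cat \<Rightarrow> ('bo, 'bm) cat \<Rightarrow> ('so, 'sm, 'ao, 'am, 'bo, 'bm) thc \<Rightarrow>
   ('sm, 'sm square, 'am, 'am square, 'bm, 'bm square) thc" where
  "leibniz_thc S A B T = \<lparr>
     tensor = leibniz_tensor S A B T,
     lhom = leibniz_lhom S A B T,
     rhom = leibniz_rhom S A B T,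
     phi = leibniz_phi S A B T,
     psi = leibniz_psi S A B T\<rparr>"

end

(* A square from f to <<u,g|| is, by the universal property of the pullback, a triple of arrows
   of A subject to three equations in which the pullback does not occur; squares out of f \<odot> u and
   squares into ||f,g>> are described in the same way. The structure isomorphisms of T carry these
   three kinds of triples componentwise into each other: by naturality they only permute the three
   equations. Since composition with squares acts componentwise on triples, naturality of the
   induced isomorphisms is inherited from T as well. *)

theory Submission
  imports Defs
begin

section \<open>Categories, duality and arrow categories\<close>

text \<open>Only a bifunctor contravariant in its first variable enters the description by triples,
  so one treatment serves all three operations: for \<open>tensor\<close> the values are taken in
  \<open>op_cat B\<close>, where the pushout corner is a pullback corner. The price is that a square
  of \<open>B\<close> must become one of \<open>op_cat B\<close>, which interchanges its top and
  bottom edges. Transposition mixes the origins of the equations. The compatibility condition at the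
  pushout turns into one half of the commutativity of a square, while one half of the commutativity
  turns into the compatibility condition at the pullback. Hence neither the corner arrow nor the
  commutativity can be transposed by itself, and the triple is the unit that is carried
  over.\<close>

lemma hom_iff: "f \<in> hom C X Y \<longleftrightarrow> f \<in> Arr C \<and> Dom C f = X \<and> Cod C f = Y"
  by (simp add: hom_def)

lemma op_cat_simps [simp]:
  "Obj (op_cat C) = Obj C" "Arr (op_cat C) = Arr C" "Dom (op_cat C) = Cod C"
  "Cod (op_cat C) = Dom C" "Ident (op_cat C) = Ident C" "g \<cdot>\<^bsub>op_cat C\<^esub> f = f \<cdot>\<^bsub>C\<^esub> g"
  "hom (op_cat C) X Y = hom C Y X"
  by (auto simp: op_cat_def hom_def)

lemma prod_cat_simps [simp]:
  "Obj (prod_cat C D) = Obj C \<times> Obj D" "Arr (prod_cat C D) = Arr C \<times> Arr D"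
  "Dom (prod_cat C D) = map_prod (Dom C) (Dom D)" "Cod (prod_cat C D) = map_prod (Cod C) (Cod D)"
  "Ident (prod_cat C D) = map_prod (Ident C) (Ident D)"
  "g \<cdot>\<^bsub>prod_cat C D\<^esub> f = (fst g \<cdot>\<^bsub>C\<^esub> fst f, snd g \<cdot>\<^bsub>D\<^esub> snd f)"
  by (auto simp: prod_cat_def)

context category
begin

lemma arr_hom: "f \<in> Arr C \<Longrightarrow> f \<in> hom C (Dom C f) (Cod C f)"
  by (simp add: hom_iff)

lemma comp_arr [simp]:
  assumes "f \<in> Arr C" "g \<in> Arr C" "Cod C f = Dom C g"
  shows "g \<cdot>\<^bsub>C\<^esub> f \<in> Arr C" "Dom C (g \<cdot>\<^bsub>C\<^esub> f) = Dom C f" "Cod C (g \<cdot>\<^bsub>C\<^esub> f) = Cod C g"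
  using comp_hom[of f "Dom C f" "Cod C f" g "Cod C g"] assms by (auto simp: hom_iff)

lemma assoc_arr [simp]:
  assumes "f \<in> Arr C" "g \<in> Arr C" "h \<in> Arr C" "Cod C f = Dom C g" "Cod C g = Dom C h"
  shows "(h \<cdot>\<^bsub>C\<^esub> g) \<cdot>\<^bsub>C\<^esub> f = h \<cdot>\<^bsub>C\<^esub> (g \<cdot>\<^bsub>C\<^esub> f)"
  using assoc[of f "Dom C f" "Cod C f" g "Cod C g" h "Cod C h"] assms by (auto simp: hom_iff)

lemma ident_arr [simp]:
  assumes "X \<in> Obj C"
  shows "Ident C X \<in> Arr C" "Dom C (Ident C X) = X" "Cod C (Ident C X) = X"
  using ident_hom[OF assms] by (auto simp: hom_iff)

lemma ident_comp [simp]: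
  assumes "f \<in> Arr C"
  shows "Cod C f = X \<Longrightarrow> Ident C X \<cdot>\<^bsub>C\<^esub> f = f" "Dom C f = X \<Longrightarrow> f \<cdot>\<^bsub>C\<^esub> Ident C X = f"
  using ident_left ident_right assms by (auto simp: hom_iff)

lemma arr_objs [simp]: "f \<in> Arr C \<Longrightarrow> Dom C f \<in> Obj C" "f \<in> Arr C \<Longrightarrow> Cod C f \<in> Obj C"
  by (simp_all add: dom_obj cod_obj)

lemma category_op_cat: "category (op_cat C)"
  by unfold_locales (auto simp: hom_iff)

lemma arrow_cat_hom_iff:
  "k \<in> hom (arrow_cat C) f g \<longleftrightarrow> f \<in> Arr C \<and> g \<in> Arr C \<and> sq_src k = f \<and> sq_tgt k = g \<and>
     sq_top k \<in> hom C (Dom C f) (Dom C g) \<and> sq_bot k \<in> hom C (Cod C f) (Cod C g) \<and>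
     g \<cdot>\<^bsub>C\<^esub> sq_top k = sq_bot k \<cdot>\<^bsub>C\<^esub> f"
  unfolding hom_iff[of k "arrow_cat C"] by (cases k) (auto simp: arrow_cat_def)

end

lemma arrow_cat_simps [simp]:
  "Obj (arrow_cat C) = Arr C" "Dom (arrow_cat C) = sq_src" "Cod (arrow_cat C) = sq_tgt"
  "Ident (arrow_cat C) f = Square f f (Ident C (Dom C f)) (Ident C (Cod C f))"
  "\<tau> \<cdot>\<^bsub>arrow_cat C\<^esub> \<sigma> = Square (sq_src \<sigma>) (sq_tgt \<tau>)
     (sq_top \<tau> \<cdot>\<^bsub>C\<^esub> sq_top \<sigma>) (sq_bot \<tau> \<cdot>\<^bsub>C\<^esub> sq_bot \<sigma>)"
  by (auto simp: arrow_cat_def)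

lemma arrow_cat_arr_iff:
  "k \<in> Arr (arrow_cat C) \<longleftrightarrow> k \<in> hom (arrow_cat C) (sq_src k) (sq_tgt k)"
  by (simp add: hom_iff)

lemma (in category) category_arrow_cat: "category (arrow_cat C)"
proof -
  \<comment> \<open>Pasting of a square from \<open>f\<close> to \<open>m\<close> with a square from
    \<open>m\<close> to \<open>g\<close>. Simplification brackets all composites to the right, while
    each commutativity has to be applied to a pair bracketed otherwise.\<close>
  have *: "g \<cdot>\<^bsub>C\<^esub> (t \<cdot>\<^bsub>C\<^esub> s) = b \<cdot>\<^bsub>C\<^esub> (d \<cdot>\<^bsub>C\<^esub> f)"
    if "g \<cdot>\<^bsub>C\<^esub> t = b \<cdot>\<^bsub>C\<^esub> m" "m \<cdot>\<^bsub>C\<^esub> s = d \<cdot>\<^bsub>C\<^esub> f"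
      "f \<in> Arr C" "g \<in> Arr C" "m \<in> Arr C" "s \<in> Arr C" "t \<in> Arr C" "b \<in> Arr C" "d \<in> Arr C"
      "Dom C m = Cod C s" "Cod C s = Dom C t" "Cod C t = Dom C g" "Cod C f = Dom C d"
      "Cod C d = Dom C b" "Dom C b = Cod C m"
    for f g m s t b d
  proof -
    have "g \<cdot>\<^bsub>C\<^esub> (t \<cdot>\<^bsub>C\<^esub> s) = (g \<cdot>\<^bsub>C\<^esub> t) \<cdot>\<^bsub>C\<^esub> s" using that(3-) by simp
    also have "\<dots> = (b \<cdot>\<^bsub>C\<^esub> m) \<cdot>\<^bsub>C\<^esub> s" by (simp only: that(1))
    also have "\<dots> = b \<cdot>\<^bsub>C\<^esub> (m \<cdot>\<^bsub>C\<^esub> s)" using that(3-) by simp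
    also have "\<dots> = b \<cdot>\<^bsub>C\<^esub> (d \<cdot>\<^bsub>C\<^esub> f)" by (simp only: that(2))
    finally show ?thesis .
  qed
  show ?thesis
  proof unfold_locales
    fix \<sigma> \<tau> f g h
    assume "\<sigma> \<in> hom (arrow_cat C) f g" "\<tau> \<in> hom (arrow_cat C) g h"
    thus "\<tau> \<cdot>\<^bsub>arrow_cat C\<^esub> \<sigma> \<in> hom (arrow_cat C) f h"
      unfolding arrow_cat_hom_iff by (auto simp: hom_iff intro!: *[where m = g])
  qed (auto simp: arrow_cat_hom_iff arrow_cat_arr_iff hom_iff[of _ C] intro!: square.expand)
qed

text \<open>Passing to the opposite category turns a square from \<open>f\<close> to \<open>g\<close> into one from \<open>g\<close> to \<open>f\<close>.\<close>

fun flip_square :: "'m square \<Rightarrow> 'm square" where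
  "flip_square (Square f g a b) = Square g f b a"

lemma flip_square_sel [simp]:
  "sq_src (flip_square k) = sq_tgt k" "sq_tgt (flip_square k) = sq_src k"
  "sq_top (flip_square k) = sq_bot k" "sq_bot (flip_square k) = sq_top k"
  "flip_square (flip_square k) = k"
  by (cases k; simp)+

lemma (in category) flip_square_hom:
  "flip_square k \<in> hom (arrow_cat (op_cat C)) g f \<longleftrightarrow> k \<in> hom (arrow_cat C) f g"
proof -
  interpret op: category "op_cat C" by (rule category_op_cat)
  show ?thesis unfolding arrow_cat_hom_iff op.arrow_cat_hom_iff by auto
qed

section \<open>Pullbacks from finite limits\<close>

text \<open>Asked of \<open>op_cat C\<close>, this is the existence of pushouts in
  \<open>C\<close>.\<close>

definition has_pullbacks :: "('o, 'm) cat \<Rightarrow> bool" where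
  "has_pullbacks C \<longleftrightarrow> (\<forall>f \<in> Arr C. \<forall>g \<in> Arr C. Cod C f = Cod C g \<longrightarrow> (\<exists>p q. is_pullback C f g p q))"

text \<open>The shape \<open>0 \<rightarrow> 2 \<leftarrow> 1\<close>: arrows \<open>0\<close>, \<open>1\<close>, \<open>2\<close> are the identities, \<open>3\<close> and \<open>4\<close> the legs.\<close>

definition cospan_shape :: "(nat, nat) cat" where
  "cospan_shape = \<lparr>Obj = {0, 1, 2}, Arr = {0, 1, 2, 3, 4},
     Dom = (\<lambda>n. if n = 3 then 0 else if n = 4 then 1 else n),
     Cod = (\<lambda>n. if n \<ge> 3 then 2 else n),
     Ident = (\<lambda>n. n), Comp = (\<lambda>g f. if f < 3 then g else f)\<rparr>"

text \<open>Both legs end at \<open>2\<close>, where only the identity starts, so every composable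
  pair contains an identity. The composition rule returns the other member: \<open>g\<close> if
  \<open>f\<close> is an identity, and otherwise \<open>f\<close>, since then \<open>g\<close> is
  the identity of \<open>2\<close>.\<close>

lemma category_cospan_shape: "category cospan_shape"
  by unfold_locales (auto simp: cospan_shape_def hom_iff)

lemma (in category) has_pullbacks:
  assumes "has_finite_limits C"
  shows "has_pullbacks C"
  unfolding has_pullbacks_def
proof (intro ballI impI)
  fix f g assume fg: "f \<in> Arr C" "g \<in> Arr C" "Cod C f = Cod C g"
  define F :: "(nat, nat, 'o, 'm) cfunctor" where
    "F = \<lparr>omap = (\<lambda>n. if n = 0 then Dom C f else if n = 1 then Dom C g else Cod C f),
       amap = (\<lambda>n. if n = 0 then Ident C (Dom C f) else if n = 1 then Ident C (Dom C g)
          else if n = 2 then Ident C (Cod C f) else if n = 3 then f else g)\<rparr>"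
  have "is_functor cospan_shape C F"
    unfolding is_functor_def F_def cospan_shape_def using fg by (auto simp: hom_iff)
  moreover have "finite (Arr cospan_shape)" by (simp add: cospan_shape_def)
  ultimately obtain N p where lim: "is_limit cospan_shape C F N p"
    using assms category_cospan_shape unfolding has_finite_limits_def by blast
  \<comment> \<open>The conditions at the three identities are automatic, so a cone is a pair of
    legs together with their common composite at vertex \<open>2\<close>.\<close>
  have cone: "is_cone cospan_shape C F W c \<longleftrightarrow> c 0 \<in> hom C W (Dom C f) \<and> c 1 \<in> hom C W (Dom C g) \<and>
     c 2 \<in> hom C W (Cod C f) \<and> f \<cdot>\<^bsub>C\<^esub> c 0 = c 2 \<and> g \<cdot>\<^bsub>C\<^esub> c 1 = c 2" for W c
    unfolding is_cone_def F_def cospan_shape_def using fg dom_obj by (auto simp: hom_iff)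
  have p: "p 0 \<in> hom C N (Dom C f)" "p 1 \<in> hom C N (Dom C g)" "f \<cdot>\<^bsub>C\<^esub> p 0 = p 2" "g \<cdot>\<^bsub>C\<^esub> p 1 = p 2"
    using lim unfolding is_limit_def cone by auto
  have "\<exists>!h. h \<in> hom C W N \<and> p 0 \<cdot>\<^bsub>C\<^esub> h = x \<and> p 1 \<cdot>\<^bsub>C\<^esub> h = y"
    if xy: "x \<in> hom C W (Dom C f)" "y \<in> hom C W (Dom C g)" "f \<cdot>\<^bsub>C\<^esub> x = g \<cdot>\<^bsub>C\<^esub> y" for W x y
  proof -
    define c where "c n = (if n = (0::nat) then x else if n = 1 then y else f \<cdot>\<^bsub>C\<^esub> x)" for n
    have "is_cone cospan_shape C F W c" unfolding cone c_def using xy fg by (auto simp: hom_iff)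
    hence "\<exists>!h. h \<in> hom C W N \<and> (\<forall>j \<in> Obj cospan_shape. p j \<cdot>\<^bsub>C\<^esub> h = c j)"
      using lim unfolding is_limit_def by blast
    moreover have "(\<forall>j \<in> Obj cospan_shape. p j \<cdot>\<^bsub>C\<^esub> h = c j) \<longleftrightarrow> p 0 \<cdot>\<^bsub>C\<^esub> h = x \<and> p 1 \<cdot>\<^bsub>C\<^esub> h = y"
      if "h \<in> hom C W N" for h
    proof -
      \<comment> \<open>The condition at vertex \<open>2\<close> follows from the one at
        \<open>0\<close>, so a mediating arrow of cones is the same as a mediating arrow of the
        pullback.\<close>
      have "p 2 \<cdot>\<^bsub>C\<^esub> h = f \<cdot>\<^bsub>C\<^esub> (p 0 \<cdot>\<^bsub>C\<^esub> h)"
        using that p fg by (auto simp: hom_iff simp flip: p(3))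
      thus ?thesis by (auto simp: cospan_shape_def c_def)
    qed
    ultimately show ?thesis by (metis (no_types, lifting))
  qed
  hence "is_pullback C f g (p 0) (p 1)"
    unfolding is_pullback_def using p fg by (auto simp: hom_iff)
  thus "\<exists>p q. is_pullback C f g p q" by blast
qed

text \<open>A diagram in the opposite category is a diagram in \<open>C\<close> on the opposite
  shape, with the same object and arrow maps, and its cones are the cocones there. The shape has to
  be reversed as well, which keeps it finite.\<close>

lemma has_finite_limits_op_cat:
  assumes "has_finite_colimits C"
  shows "has_finite_limits (op_cat C)"
  unfolding has_finite_limits_def
proof (intro allI impI)
  fix J :: "(nat, nat) cat" and F
  assume J: "category J \<and> finite (Arr J) \<and> is_functor J (op_cat C) F"
  have "category (op_cat J)" using J category.category_op_cat by blast
  moreover have "is_functor (op_cat J) C F" using J by (auto simp: is_functor_def)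
  ultimately obtain N i where "is_colimit (op_cat J) C F N i"
    using assms J unfolding has_finite_colimits_def by (metis op_cat_simps(2))
  hence "is_limit J (op_cat C) F N i"
    unfolding is_limit_def is_colimit_def is_cone_def is_cocone_def by simp
  thus "\<exists>N p. is_limit J (op_cat C) F N p" by blast
qed

lemma is_pullback_op_cat: "is_pullback (op_cat C) = is_pushout C"
  by (intro ext) (simp add: is_pullback_def is_pushout_def)

text \<open>The predicates to be chosen from coincide, so \<open>SOME\<close> picks the same legs.
  The chosen pushouts are thus equal, not merely isomorphic, to the chosen pullbacks of the opposite
  category, and no comparison isomorphism has to be carried along.\<close>

lemma pullback_op_cat:
  "pb1 (op_cat C) = po1 C" "pb2 (op_cat C) = po2 C" "pb_pair (op_cat C) = po_copair C"
  by (intro ext, simp add: is_pullback_op_cat pb1_def pb2_def po1_def po2_def pullback_def pushout_def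
      pb_pair_def po_copair_def)+


section \<open>The Leibniz construction for a single bifunctor\<close>

text \<open>Asks for functoriality but for no adjunction, so that it can be interpreted once for
  each of the three functors of a THC situation.\<close>

locale leibniz_corner =
  S: category S + A: category A + B: category B
  for S :: "('so, 'sm) cat" and A :: "('ao, 'am) cat" and B :: "('bo, 'bm) cat" +
  fixes T :: "('so, 'sm, 'ao, 'am, 'bo, 'bm) thc"
  assumes lhom_functor: "is_functor (prod_cat (op_cat S) B) A (lhom T)"
    and pullbacks: "has_pullbacks A"
begin

abbreviation H :: "'sm \<Rightarrow> 'bm \<Rightarrow> 'am" where "H s b \<equiv> amap (lhom T) (s, b)"
abbreviation Ho :: "'so \<Rightarrow> 'bo \<Rightarrow> 'ao" where "Ho z y \<equiv> omap (lhom T) (z, y)"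
abbreviation obj :: "'sm \<Rightarrow> 'bm \<Rightarrow> 'am" where "obj \<equiv> leibniz_lhom_obj S A B T"
abbreviation pr1 :: "'sm \<Rightarrow> 'bm \<Rightarrow> 'am" where "pr1 \<equiv> lhom_pr1 S A B T"
abbreviation pr2 :: "'sm \<Rightarrow> 'bm \<Rightarrow> 'am" where "pr2 \<equiv> lhom_pr2 S A B T"
abbreviation pair :: "'sm \<Rightarrow> 'bm \<Rightarrow> 'am \<Rightarrow> 'am \<Rightarrow> 'am" where "pair \<equiv> lhom_pair S A B T"
abbreviation Pb :: "'sm \<Rightarrow> 'bm \<Rightarrow> 'ao" where "Pb u g \<equiv> Dom A (pr1 u g)"

lemma Ho_obj [simp]: "z \<in> Obj S \<Longrightarrow> y \<in> Obj B \<Longrightarrow> Ho z y \<in> Obj A"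
  using lhom_functor by (auto simp: is_functor_def)

lemma H_arr [simp]:
  assumes "s \<in> Arr S" "b \<in> Arr B"
  shows "H s b \<in> Arr A" "Dom A (H s b) = Ho (Cod S s) (Dom B b)" "Cod A (H s b) = Ho (Dom S s) (Cod B b)"
  using lhom_functor assms by (auto simp: is_functor_def hom_iff)

lemma H_ident [simp]: "z \<in> Obj S \<Longrightarrow> y \<in> Obj B \<Longrightarrow> H (Ident S z) (Ident B y) = Ident A (Ho z y)"
  using lhom_functor by (auto simp: is_functor_def)

lemma H_comp:
  assumes "s \<in> Arr S" "b \<in> Arr B" "s' \<in> Arr S" "b' \<in> Arr B" "Dom S s = Cod S s'" "Cod B b = Dom B b'"
  shows "H s' b' \<cdot>\<^bsub>A\<^esub> H s b = H (s \<cdot>\<^bsub>S\<^esub> s') (b' \<cdot>\<^bsub>B\<^esub> b)"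
proof -
  have "(s, b) \<in> Arr (prod_cat (op_cat S) B)" "(s', b') \<in> Arr (prod_cat (op_cat S) B)"
    "Cod (prod_cat (op_cat S) B) (s, b) = Dom (prod_cat (op_cat S) B) (s', b')"
    using assms by auto
  hence "amap (lhom T) ((s', b') \<cdot>\<^bsub>prod_cat (op_cat S) B\<^esub> (s, b)) = H s' b' \<cdot>\<^bsub>A\<^esub> H s b"
    using lhom_functor unfolding is_functor_def by blast
  thus ?thesis by simp
qed

text \<open>Needed beside \<open>H_comp\<close> because in composites bracketed to the right two
  adjacent \<open>H\<close> do not form a subterm.\<close>

lemma H_comp_comp:
  assumes "s \<in> Arr S" "b \<in> Arr B" "s' \<in> Arr S" "b' \<in> Arr B" "Dom S s = Cod S s'" "Cod B b = Dom B b'"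
    and "x \<in> Arr A" "Cod A x = Ho (Cod S s) (Dom B b)"
  shows "H s' b' \<cdot>\<^bsub>A\<^esub> (H s b \<cdot>\<^bsub>A\<^esub> x) = H (s \<cdot>\<^bsub>S\<^esub> s') (b' \<cdot>\<^bsub>B\<^esub> b) \<cdot>\<^bsub>A\<^esub> x"
proof -
  have "H s' b' \<cdot>\<^bsub>A\<^esub> (H s b \<cdot>\<^bsub>A\<^esub> x) = (H s' b' \<cdot>\<^bsub>A\<^esub> H s b) \<cdot>\<^bsub>A\<^esub> x" using assms by simp
  thus ?thesis using assms by (simp add: H_comp)
qed

section \<open>Arrows and squares into the corner\<close>

context
  fixes u :: 'sm and g :: 'bm
  assumes u [simp]: "u \<in> Arr S" and g [simp]: "g \<in> Arr B"
begin

lemma corner_pullback: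
  "is_pullback A (H (Ident S (Dom S u)) g) (H u (Ident B (Cod B g))) (pr1 u g) (pr2 u g)"
proof -
  have "\<exists>p q. is_pullback A (H (Ident S (Dom S u)) g) (H u (Ident B (Cod B g))) p q"
    using pullbacks by (simp add: has_pullbacks_def)
  hence "\<exists>pq. is_pullback A (H (Ident S (Dom S u)) g) (H u (Ident B (Cod B g))) (fst pq) (snd pq)"
    by simp
  thus ?thesis
    unfolding lhom_pr1_def lhom_pr2_def lhom_cospan1_def lhom_cospan2_def pb1_def pb2_def pullback_def
    by (rule someI_ex)
qed

lemma pr_arr [simp]:
  "pr1 u g \<in> Arr A" "Cod A (pr1 u g) = Ho (Dom S u) (Dom B g)"
  "pr2 u g \<in> Arr A" "Dom A (pr2 u g) = Pb u g" "Cod A (pr2 u g) = Ho (Cod S u) (Cod B g)"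
  using corner_pullback by (auto simp: is_pullback_def hom_iff)

lemma pr_square: "H (Ident S (Dom S u)) g \<cdot>\<^bsub>A\<^esub> pr1 u g = H u (Ident B (Cod B g)) \<cdot>\<^bsub>A\<^esub> pr2 u g"
  using corner_pullback by (simp add: is_pullback_def)

lemma pair_ex1:
  assumes "x \<in> hom A W (Ho (Dom S u) (Dom B g))" "y \<in> hom A W (Ho (Cod S u) (Cod B g))"
    and "H (Ident S (Dom S u)) g \<cdot>\<^bsub>A\<^esub> x = H u (Ident B (Cod B g)) \<cdot>\<^bsub>A\<^esub> y"
  shows "\<exists>!h. h \<in> hom A W (Pb u g) \<and> pr1 u g \<cdot>\<^bsub>A\<^esub> h = x \<and> pr2 u g \<cdot>\<^bsub>A\<^esub> h = y"
  using corner_pullback assms by (simp add: is_pullback_def)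

lemma pair:
  assumes "x \<in> hom A W (Ho (Dom S u) (Dom B g))" "y \<in> hom A W (Ho (Cod S u) (Cod B g))"
    and "H (Ident S (Dom S u)) g \<cdot>\<^bsub>A\<^esub> x = H u (Ident B (Cod B g)) \<cdot>\<^bsub>A\<^esub> y"
  shows "pair u g x y \<in> hom A W (Pb u g)"
    and "pr1 u g \<cdot>\<^bsub>A\<^esub> pair u g x y = x" and "pr2 u g \<cdot>\<^bsub>A\<^esub> pair u g x y = y"
proof -
  have "pair u g x y = (THE h. h \<in> hom A W (Pb u g) \<and> pr1 u g \<cdot>\<^bsub>A\<^esub> h = x \<and> pr2 u g \<cdot>\<^bsub>A\<^esub> h = y)"
    using assms(1) by (simp add: lhom_pair_def pb_pair_def lhom_pr1_def lhom_pr2_def hom_iff)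
  with theI'[OF pair_ex1[OF assms]]
  show "pair u g x y \<in> hom A W (Pb u g)"
    and "pr1 u g \<cdot>\<^bsub>A\<^esub> pair u g x y = x" and "pr2 u g \<cdot>\<^bsub>A\<^esub> pair u g x y = y"
    by simp_all
qed

text \<open>Composing \<open>pr_square\<close> with \<open>h\<close> shows that the two projections
  of \<open>h\<close> are compatible; \<open>h\<close> and \<open>h'\<close> then both solve the
  same universal problem.\<close>

lemma pr_jointly_monic:
  assumes "h \<in> hom A W (Pb u g)" "h' \<in> hom A W (Pb u g)"
    and "pr1 u g \<cdot>\<^bsub>A\<^esub> h = pr1 u g \<cdot>\<^bsub>A\<^esub> h'" "pr2 u g \<cdot>\<^bsub>A\<^esub> h = pr2 u g \<cdot>\<^bsub>A\<^esub> h'"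
  shows "h = h'"
proof -
  have "H (Ident S (Dom S u)) g \<cdot>\<^bsub>A\<^esub> (pr1 u g \<cdot>\<^bsub>A\<^esub> h) = (H (Ident S (Dom S u)) g \<cdot>\<^bsub>A\<^esub> pr1 u g) \<cdot>\<^bsub>A\<^esub> h"
    using assms(1) by (simp add: hom_iff)
  also have "\<dots> = H u (Ident B (Cod B g)) \<cdot>\<^bsub>A\<^esub> (pr2 u g \<cdot>\<^bsub>A\<^esub> h)"
    unfolding pr_square using assms(1) by (simp add: hom_iff)
  finally have *: "H (Ident S (Dom S u)) g \<cdot>\<^bsub>A\<^esub> (pr1 u g \<cdot>\<^bsub>A\<^esub> h) =
    H u (Ident B (Cod B g)) \<cdot>\<^bsub>A\<^esub> (pr2 u g \<cdot>\<^bsub>A\<^esub> h)" .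
  have "\<exists>!k. k \<in> hom A W (Pb u g) \<and> pr1 u g \<cdot>\<^bsub>A\<^esub> k = pr1 u g \<cdot>\<^bsub>A\<^esub> h \<and> pr2 u g \<cdot>\<^bsub>A\<^esub> k = pr2 u g \<cdot>\<^bsub>A\<^esub> h"
    by (rule pair_ex1[OF _ _ *]) (use assms(1) in \<open>auto simp: hom_iff\<close>)
  thus ?thesis using assms by metis
qed

text \<open>Both composites in the compatibility condition are \<open>H u g\<close>, by
  functoriality in the two variables together.\<close>

lemma obj_pair:
  shows obj_hom: "obj u g \<in> hom A (Ho (Cod S u) (Dom B g)) (Pb u g)"
    and pr1_obj: "pr1 u g \<cdot>\<^bsub>A\<^esub> obj u g = H u (Ident B (Dom B g))"
    and pr2_obj: "pr2 u g \<cdot>\<^bsub>A\<^esub> obj u g = H (Ident S (Cod S u)) g"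
  unfolding leibniz_lhom_obj_def
  by (rule pair[where W = "Ho (Cod S u) (Dom B g)"]; simp add: hom_iff H_comp)+

lemma obj_arr [simp]:
  "obj u g \<in> Arr A" "Dom A (obj u g) = Ho (Cod S u) (Dom B g)" "Cod A (obj u g) = Pb u g"
  using obj_hom by (simp_all add: hom_iff)

text \<open>By the universal property of the corner, a square from \<open>f\<close> to \<open>obj u g\<close> is a triple of arrows
  subject to three equations that do not mention the corner.\<close>

definition corner_data :: "'am \<Rightarrow> ('am \<times> 'am \<times> 'am) set" where
  "corner_data f = {(a, x, y).
     (a \<in> hom A (Dom A f) (Ho (Cod S u) (Dom B g)) \<and>
      x \<in> hom A (Cod A f) (Ho (Dom S u) (Dom B g)) \<and>
      y \<in> hom A (Cod A f) (Ho (Cod S u) (Cod B g))) \<and>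
     x \<cdot>\<^bsub>A\<^esub> f = H u (Ident B (Dom B g)) \<cdot>\<^bsub>A\<^esub> a \<and>
     y \<cdot>\<^bsub>A\<^esub> f = H (Ident S (Cod S u)) g \<cdot>\<^bsub>A\<^esub> a \<and>
     H (Ident S (Dom S u)) g \<cdot>\<^bsub>A\<^esub> x = H u (Ident B (Cod B g)) \<cdot>\<^bsub>A\<^esub> y}"

definition components :: "'am square \<Rightarrow> 'am \<times> 'am \<times> 'am" where
  "components k = (sq_top k, pr1 u g \<cdot>\<^bsub>A\<^esub> sq_bot k, pr2 u g \<cdot>\<^bsub>A\<^esub> sq_bot k)"

definition square_of :: "'am \<Rightarrow> 'am \<times> 'am \<times> 'am \<Rightarrow> 'am square" where
  "square_of f = (\<lambda>(a, x, y). Square f (obj u g) a (pair u g x y))"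

text \<open>The first two equations are the commutativity of the square seen through
  \<open>pr1\<close> and \<open>pr2\<close>; the third is \<open>pr_square\<close> composed with the
  bottom edge.\<close>

lemma components_in_data:
  assumes k: "k \<in> hom (arrow_cat A) f (obj u g)"
  shows "components k \<in> corner_data f"
proof -
  let ?a = "sq_top k" and ?b = "sq_bot k"
  have k': "f \<in> Arr A" "?a \<in> Arr A" "?b \<in> Arr A" "Dom A ?a = Dom A f" "Dom A ?b = Cod A f"
    "Cod A ?a = Ho (Cod S u) (Dom B g)" "Cod A ?b = Pb u g" and sq: "obj u g \<cdot>\<^bsub>A\<^esub> ?a = ?b \<cdot>\<^bsub>A\<^esub> f"
    using k unfolding A.arrow_cat_hom_iff by (auto simp: hom_iff)
  have "pr1 u g \<cdot>\<^bsub>A\<^esub> (?b \<cdot>\<^bsub>A\<^esub> f) = (pr1 u g \<cdot>\<^bsub>A\<^esub> obj u g) \<cdot>\<^bsub>A\<^esub> ?a"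
    unfolding sq[symmetric] using k' by simp
  moreover have "pr2 u g \<cdot>\<^bsub>A\<^esub> (?b \<cdot>\<^bsub>A\<^esub> f) = (pr2 u g \<cdot>\<^bsub>A\<^esub> obj u g) \<cdot>\<^bsub>A\<^esub> ?a"
    unfolding sq[symmetric] using k' by simp
  moreover have "H (Ident S (Dom S u)) g \<cdot>\<^bsub>A\<^esub> (pr1 u g \<cdot>\<^bsub>A\<^esub> ?b) =
      (H (Ident S (Dom S u)) g \<cdot>\<^bsub>A\<^esub> pr1 u g) \<cdot>\<^bsub>A\<^esub> ?b"
    using k' by simp
  moreover have "\<dots> = H u (Ident B (Cod B g)) \<cdot>\<^bsub>A\<^esub> (pr2 u g \<cdot>\<^bsub>A\<^esub> ?b)"
    unfolding pr_square using k' by simp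
  ultimately show ?thesis
    unfolding components_def corner_data_def using k' by (simp add: hom_iff pr1_obj pr2_obj)
qed

lemma square_of_hom:
  assumes f: "f \<in> Arr A" and d: "d \<in> corner_data f"
  shows "square_of f d \<in> hom (arrow_cat A) f (obj u g)" and "components (square_of f d) = d"
proof -
  obtain a x y where d_eq: "d = (a, x, y)" by (cases d)
  have a: "a \<in> hom A (Dom A f) (Ho (Cod S u) (Dom B g))"
    and x: "x \<in> hom A (Cod A f) (Ho (Dom S u) (Dom B g))"
    and y: "y \<in> hom A (Cod A f) (Ho (Cod S u) (Cod B g))"
    and xf: "x \<cdot>\<^bsub>A\<^esub> f = H u (Ident B (Dom B g)) \<cdot>\<^bsub>A\<^esub> a"
    and yf: "y \<cdot>\<^bsub>A\<^esub> f = H (Ident S (Cod S u)) g \<cdot>\<^bsub>A\<^esub> a"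
    and xy: "H (Ident S (Dom S u)) g \<cdot>\<^bsub>A\<^esub> x = H u (Ident B (Cod B g)) \<cdot>\<^bsub>A\<^esub> y"
    using d unfolding d_eq corner_data_def by auto
  note p = pair[OF x y xy]
  have arr: "pair u g x y \<in> Arr A" "Dom A (pair u g x y) = Cod A f" "Cod A (pair u g x y) = Pb u g"
    "a \<in> Arr A" "Dom A a = Dom A f" "Cod A a = Ho (Cod S u) (Dom B g)"
    using p(1) a by (auto simp: hom_iff)
  \<comment> \<open>Two arrows into the corner are compared after both projections; there the claim
    is the first, respectively the second, equation of the triple.\<close>
  have "obj u g \<cdot>\<^bsub>A\<^esub> a = pair u g x y \<cdot>\<^bsub>A\<^esub> f"
  proof (rule pr_jointly_monic)
    have "pr1 u g \<cdot>\<^bsub>A\<^esub> (obj u g \<cdot>\<^bsub>A\<^esub> a) = (pr1 u g \<cdot>\<^bsub>A\<^esub> obj u g) \<cdot>\<^bsub>A\<^esub> a" using arr by simp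
    also have "\<dots> = (pr1 u g \<cdot>\<^bsub>A\<^esub> pair u g x y) \<cdot>\<^bsub>A\<^esub> f" by (simp only: pr1_obj p xf)
    finally show "pr1 u g \<cdot>\<^bsub>A\<^esub> (obj u g \<cdot>\<^bsub>A\<^esub> a) = pr1 u g \<cdot>\<^bsub>A\<^esub> (pair u g x y \<cdot>\<^bsub>A\<^esub> f)"
      using arr f by simp
    have "pr2 u g \<cdot>\<^bsub>A\<^esub> (obj u g \<cdot>\<^bsub>A\<^esub> a) = (pr2 u g \<cdot>\<^bsub>A\<^esub> obj u g) \<cdot>\<^bsub>A\<^esub> a" using arr by simp
    also have "\<dots> = (pr2 u g \<cdot>\<^bsub>A\<^esub> pair u g x y) \<cdot>\<^bsub>A\<^esub> f" by (simp only: pr2_obj p yf)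
    finally show "pr2 u g \<cdot>\<^bsub>A\<^esub> (obj u g \<cdot>\<^bsub>A\<^esub> a) = pr2 u g \<cdot>\<^bsub>A\<^esub> (pair u g x y \<cdot>\<^bsub>A\<^esub> f)"
      using arr f by simp
  qed (use arr f in \<open>auto simp: hom_iff\<close>)
  thus "square_of f d \<in> hom (arrow_cat A) f (obj u g)"
    unfolding d_eq square_of_def A.arrow_cat_hom_iff using arr f by (simp add: hom_iff)
  show "components (square_of f d) = d"
    unfolding d_eq square_of_def components_def by (simp add: p)
qed

text \<open>The tool behind functoriality and all naturality statements below: equations between
  squares are checked on triples, where the universal property no longer appears.\<close>

lemma square_eqI:
  assumes "k \<in> hom (arrow_cat A) f (obj u g)" "k' \<in> hom (arrow_cat A) f (obj u g)"
    and "components k = components k'"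
  shows "k = k'"
  using assms pr_jointly_monic[of "sq_bot k" "Cod A f" "sq_bot k'"]
  by (auto simp: A.arrow_cat_hom_iff components_def intro!: square.expand)

lemma bij_components:
  assumes "f \<in> Arr A"
  shows "bij_betw components (hom (arrow_cat A) f (obj u g)) (corner_data f)"
    and "bij_betw (square_of f) (corner_data f) (hom (arrow_cat A) f (obj u g))"
proof -
  have 1: "square_of f (components k) = k" if "k \<in> hom (arrow_cat A) f (obj u g)" for k
    using that square_of_hom[OF assms components_in_data[OF that]] square_eqI by blast
  show "bij_betw components (hom (arrow_cat A) f (obj u g)) (corner_data f)"
    by (rule bij_betw_byWitness[where f' = "square_of f"])
      (use 1 square_of_hom[OF assms] components_in_data in auto)
  show "bij_betw (square_of f) (corner_data f) (hom (arrow_cat A) f (obj u g))"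
    by (rule bij_betw_byWitness[where f' = components])
      (use 1 square_of_hom[OF assms] components_in_data in auto)
qed

end

lemma components_comp:
  assumes "u \<in> Arr S" "g \<in> Arr B"
    and "k \<in> hom (arrow_cat A) f (obj u g)" "s \<in> hom (arrow_cat A) f' f"
  shows "components u g (k \<cdot>\<^bsub>arrow_cat A\<^esub> s) =
    (case components u g k of (a, x, y) \<Rightarrow> (a \<cdot>\<^bsub>A\<^esub> sq_top s, x \<cdot>\<^bsub>A\<^esub> sq_bot s, y \<cdot>\<^bsub>A\<^esub> sq_bot s))"
  using assms unfolding A.arrow_cat_hom_iff by (auto simp: components_def hom_iff)

section \<open>Action on squares and functoriality\<close>

abbreviation L :: "'sm square \<Rightarrow> 'bm square \<Rightarrow> 'am square" where
  "L \<tau> \<rho> \<equiv> amap (leibniz_lhom S A B T) (\<tau>, \<rho>)"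

context
  fixes \<tau> :: "'sm square" and \<rho> :: "'bm square" and u u' :: 'sm and g g' :: 'bm
  assumes \<tau>: "\<tau> \<in> hom (arrow_cat S) u' u" and \<rho>: "\<rho> \<in> hom (arrow_cat B) g g'"
begin

lemma squares_arr:
  "u \<in> Arr S" "u' \<in> Arr S" "sq_src \<tau> = u'" "sq_tgt \<tau> = u"
  "sq_top \<tau> \<in> Arr S" "Dom S (sq_top \<tau>) = Dom S u'" "Cod S (sq_top \<tau>) = Dom S u"
  "sq_bot \<tau> \<in> Arr S" "Dom S (sq_bot \<tau>) = Cod S u'" "Cod S (sq_bot \<tau>) = Cod S u"
  "g \<in> Arr B" "g' \<in> Arr B" "sq_src \<rho> = g" "sq_tgt \<rho> = g'"
  "sq_top \<rho> \<in> Arr B" "Dom B (sq_top \<rho>) = Dom B g" "Cod B (sq_top \<rho>) = Dom B g'"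
  "sq_bot \<rho> \<in> Arr B" "Dom B (sq_bot \<rho>) = Cod B g" "Cod B (sq_bot \<rho>) = Cod B g'"
  using \<tau> \<rho> unfolding S.arrow_cat_hom_iff B.arrow_cat_hom_iff by (auto simp: hom_iff)

lemma squares_commute:
  "u \<cdot>\<^bsub>S\<^esub> sq_top \<tau> = sq_bot \<tau> \<cdot>\<^bsub>S\<^esub> u'" "g' \<cdot>\<^bsub>B\<^esub> sq_top \<rho> = sq_bot \<rho> \<cdot>\<^bsub>B\<^esub> g"
  using \<tau> \<rho> unfolding S.arrow_cat_hom_iff B.arrow_cat_hom_iff by auto

lemma L_eq:
  "L \<tau> \<rho> = square_of u' g' (obj u g) (H (sq_bot \<tau>) (sq_top \<rho>),
     H (sq_top \<tau>) (sq_top \<rho>) \<cdot>\<^bsub>A\<^esub> pr1 u g, H (sq_bot \<tau>) (sq_bot \<rho>) \<cdot>\<^bsub>A\<^esub> pr2 u g)"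
  by (simp add: leibniz_lhom_def square_of_def squares_arr)

lemma L_data:
  "(H (sq_bot \<tau>) (sq_top \<rho>), H (sq_top \<tau>) (sq_top \<rho>) \<cdot>\<^bsub>A\<^esub> pr1 u g,
    H (sq_bot \<tau>) (sq_bot \<rho>) \<cdot>\<^bsub>A\<^esub> pr2 u g) \<in> corner_data u' g' (obj u g)"
proof -
  \<comment> \<open>Both sides pass through \<open>H (sq_top \<tau>) (sq_bot \<rho>)\<close>:
    commutativity of \<rho> leads to it, \<open>pr_square\<close> changes the projection, and
    commutativity of \<tau> leads away from it.\<close>
  have "H (Ident S (Dom S u')) g' \<cdot>\<^bsub>A\<^esub> (H (sq_top \<tau>) (sq_top \<rho>) \<cdot>\<^bsub>A\<^esub> pr1 u g) =
      H (sq_top \<tau>) (sq_bot \<rho>) \<cdot>\<^bsub>A\<^esub> (H (Ident S (Dom S u)) g \<cdot>\<^bsub>A\<^esub> pr1 u g)"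
    by (simp add: H_comp_comp squares_commute squares_arr)
  also have "\<dots> = H (sq_top \<tau>) (sq_bot \<rho>) \<cdot>\<^bsub>A\<^esub> (H u (Ident B (Cod B g)) \<cdot>\<^bsub>A\<^esub> pr2 u g)"
    by (simp add: pr_square squares_arr)
  also have "\<dots> = H u' (Ident B (Cod B g')) \<cdot>\<^bsub>A\<^esub> (H (sq_bot \<tau>) (sq_bot \<rho>) \<cdot>\<^bsub>A\<^esub> pr2 u g)"
    by (simp add: H_comp_comp squares_commute squares_arr)
  finally show ?thesis
    by (simp add: corner_data_def hom_iff pr1_obj pr2_obj H_comp squares_commute squares_arr)
qed

lemma L_hom: "L \<tau> \<rho> \<in> hom (arrow_cat A) (obj u g) (obj u' g')"
  unfolding L_eq by (rule square_of_hom) (simp_all add: L_data squares_arr)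

lemma components_L:
  "components u' g' (L \<tau> \<rho>) = (H (sq_bot \<tau>) (sq_top \<rho>),
     H (sq_top \<tau>) (sq_top \<rho>) \<cdot>\<^bsub>A\<^esub> pr1 u g, H (sq_bot \<tau>) (sq_bot \<rho>) \<cdot>\<^bsub>A\<^esub> pr2 u g)"
  unfolding L_eq by (rule square_of_hom) (simp_all add: L_data squares_arr)

text \<open>The composite is treated as \<open>L \<tau> \<rho>\<close> precomposed with
  \<open>k\<close>. The projections of the old corner in \<open>components_L\<close> then meet the
  bottom edge of \<open>k\<close> and form the components of \<open>k\<close>.\<close>

lemma components_L_comp:
  assumes k: "k \<in> hom (arrow_cat A) f (obj u g)"
  shows "components u' g' (L \<tau> \<rho> \<cdot>\<^bsub>arrow_cat A\<^esub> k) =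
    (case components u g k of (a, x, y) \<Rightarrow> (H (sq_bot \<tau>) (sq_top \<rho>) \<cdot>\<^bsub>A\<^esub> a,
      H (sq_top \<tau>) (sq_top \<rho>) \<cdot>\<^bsub>A\<^esub> x, H (sq_bot \<tau>) (sq_bot \<rho>) \<cdot>\<^bsub>A\<^esub> y))"
  using k unfolding components_comp[OF squares_arr(2,12) L_hom k] components_L
  unfolding A.arrow_cat_hom_iff by (simp add: components_def hom_iff squares_arr)

end

text \<open>On triples the two functor laws become those of \<open>lhom T\<close>, entry by
  entry.\<close>

lemma leibniz_lhom_functor:
  "is_functor (prod_cat (op_cat (arrow_cat S)) (arrow_cat B)) (arrow_cat A) (leibniz_lhom S A B T)"
  unfolding is_functor_def
proof (intro conjI ballI impI)
  have omap_eq: "omap (leibniz_lhom S A B T) (u, g) = obj u g" for u g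
    by (simp add: leibniz_lhom_def)
  interpret arr: category "arrow_cat A" by (rule A.category_arrow_cat)
  interpret arrS: category "arrow_cat S" by (rule S.category_arrow_cat)
  interpret arrB: category "arrow_cat B" by (rule B.category_arrow_cat)
  fix X assume X: "X \<in> Obj (prod_cat (op_cat (arrow_cat S)) (arrow_cat B))"
  then obtain u g where ug: "X = (u, g)" "u \<in> Arr S" "g \<in> Arr B" by auto
  show "omap (leibniz_lhom S A B T) X \<in> Obj (arrow_cat A)"
    using ug by (simp add: omap_eq)
  have 1: "Ident (arrow_cat S) u \<in> hom (arrow_cat S) u u" "Ident (arrow_cat B) g \<in> hom (arrow_cat B) g g"
    "Ident (arrow_cat A) (obj u g) \<in> hom (arrow_cat A) (obj u g) (obj u g)"
    using ug by (auto simp: arrS.ident_hom arrB.ident_hom arr.ident_hom simp del: arrow_cat_simps(4))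
  \<comment> \<open>The identity squares stay folded until \<open>components_L\<close> has been
    applied, since its premises speak of them in that form.\<close>
  have "L (Ident (arrow_cat S) u) (Ident (arrow_cat B) g) = Ident (arrow_cat A) (obj u g)"
    by (rule square_eqI[OF ug(2,3) L_hom[OF 1(1,2)] 1(3)])
      (simp add: components_L[OF 1(1,2)] del: arrow_cat_simps(4), simp add: ug components_def)
  thus "amap (leibniz_lhom S A B T) (Ident (prod_cat (op_cat (arrow_cat S)) (arrow_cat B)) X) =
      Ident (arrow_cat A) (omap (leibniz_lhom S A B T) X)"
    using ug by (simp add: omap_eq)
next
  fix p assume "p \<in> Arr (prod_cat (op_cat (arrow_cat S)) (arrow_cat B))"
  then obtain \<tau> \<rho> where p: "p = (\<tau>, \<rho>)" "\<tau> \<in> hom (arrow_cat S) (sq_src \<tau>) (sq_tgt \<tau>)"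
    "\<rho> \<in> hom (arrow_cat B) (sq_src \<rho>) (sq_tgt \<rho>)" by (auto simp: arrow_cat_arr_iff)
  show "amap (leibniz_lhom S A B T) p \<in> hom (arrow_cat A)
      (omap (leibniz_lhom S A B T) (Dom (prod_cat (op_cat (arrow_cat S)) (arrow_cat B)) p))
      (omap (leibniz_lhom S A B T) (Cod (prod_cat (op_cat (arrow_cat S)) (arrow_cat B)) p))"
    using L_hom[OF p(2,3)] by (simp add: p(1) leibniz_lhom_def)
next
  interpret arr: category "arrow_cat A" by (rule A.category_arrow_cat)
  interpret arrS: category "arrow_cat S" by (rule S.category_arrow_cat)
  interpret arrB: category "arrow_cat B" by (rule B.category_arrow_cat)
  fix p q assume "p \<in> Arr (prod_cat (op_cat (arrow_cat S)) (arrow_cat B))"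
    "q \<in> Arr (prod_cat (op_cat (arrow_cat S)) (arrow_cat B))"
    "Cod (prod_cat (op_cat (arrow_cat S)) (arrow_cat B)) p =
     Dom (prod_cat (op_cat (arrow_cat S)) (arrow_cat B)) q"
  then obtain \<tau> \<rho> \<tau>' \<rho>' u u' u'' g g' g'' where pq: "p = (\<tau>, \<rho>)" "q = (\<tau>', \<rho>')"
    "\<tau> \<in> hom (arrow_cat S) u' u" "\<tau>' \<in> hom (arrow_cat S) u'' u'"
    "\<rho> \<in> hom (arrow_cat B) g g'" "\<rho>' \<in> hom (arrow_cat B) g' g''"
    by (cases p; cases q) (auto simp: arrow_cat_arr_iff)
  note comp = arrS.comp_hom[OF pq(4,3)] arrB.comp_hom[OF pq(5,6)]
  note arrs = squares_arr[OF pq(3,5)] squares_arr[OF pq(4,6)]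
  have "L (\<tau> \<cdot>\<^bsub>arrow_cat S\<^esub> \<tau>') (\<rho>' \<cdot>\<^bsub>arrow_cat B\<^esub> \<rho>) = L \<tau>' \<rho>' \<cdot>\<^bsub>arrow_cat A\<^esub> L \<tau> \<rho>"
  proof (rule square_eqI)
    show "components u'' g'' (L (\<tau> \<cdot>\<^bsub>arrow_cat S\<^esub> \<tau>') (\<rho>' \<cdot>\<^bsub>arrow_cat B\<^esub> \<rho>)) =
        components u'' g'' (L \<tau>' \<rho>' \<cdot>\<^bsub>arrow_cat A\<^esub> L \<tau> \<rho>)"
      unfolding components_L_comp[OF pq(4,6) L_hom[OF pq(3,5)]] components_L[OF comp]
        components_L[OF pq(3,5)]
      using arrs by (simp add: H_comp H_comp_comp)
  qed (use arrs L_hom[OF comp] arr.comp_hom[OF L_hom[OF pq(3,5)] L_hom[OF pq(4,6)]] in auto)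
  thus "amap (leibniz_lhom S A B T) (q \<cdot>\<^bsub>prod_cat (op_cat (arrow_cat S)) (arrow_cat B)\<^esub> p) =
      amap (leibniz_lhom S A B T) q \<cdot>\<^bsub>arrow_cat A\<^esub> amap (leibniz_lhom S A B T) p"
    by (simp add: pq(1,2))
qed

end


section \<open>The Leibniz THC situation\<close>

text \<open>The other two operations are instances of the construction above: \<open>||f,g\<rangle>\<rangle>\<close> is obtained by
  exchanging \<open>S\<close> and \<open>A\<close>, and \<open>f \<odot> u\<close> by viewing \<open>tensor T\<close>, with its arguments exchanged, as a
  functor from \<open>op S \<times> op A\<close>, in which the first argument is contravariant, to \<open>op B\<close>.
  As the construction only looks at the field \<open>lhom\<close>, the other fields are left unspecified.\<close>

definition thc_of_lhom ::
  "('so \<times> 'bo, 'sm \<times> 'bm, 'ao, 'am) cfunctor \<Rightarrow> ('so, 'sm, 'ao, 'am, 'bo, 'bm) thc" where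
  "thc_of_lhom F =
     \<lparr>tensor = undefined, lhom = F, rhom = undefined, phi = undefined, psi = undefined\<rparr>"

definition rhom_thc ::
  "('so, 'sm, 'ao, 'am, 'bo, 'bm) thc \<Rightarrow> ('ao, 'am, 'so, 'sm, 'bo, 'bm) thc" where
  "rhom_thc T = thc_of_lhom (rhom T)"

definition tensor_thc ::
  "('so, 'sm, 'ao, 'am, 'bo, 'bm) thc \<Rightarrow> ('so, 'sm, 'bo, 'bm, 'ao, 'am) thc" where
  "tensor_thc T = thc_of_lhom
     \<lparr>omap = (\<lambda>(z, x). omap (tensor T) (x, z)), amap = (\<lambda>(s, a). amap (tensor T) (a, s))\<rparr>"

lemma lhom_rhom_thc [simp]: "lhom (rhom_thc T) = rhom T"
  by (simp add: rhom_thc_def thc_of_lhom_def)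

lemma lhom_tensor_thc [simp]:
  "omap (lhom (tensor_thc T)) (z, x) = omap (tensor T) (x, z)"
  "amap (lhom (tensor_thc T)) (s, a) = amap (tensor T) (a, s)"
  by (simp_all add: tensor_thc_def thc_of_lhom_def)

text \<open>Exchanging \<open>A\<close> and \<open>S\<close> makes the two families of definitions
  agree literally, so facts about the corner transfer by rewriting.\<close>

lemma leibniz_rhom_thc:
  "leibniz_lhom_obj A S B (rhom_thc T) = leibniz_rhom_obj S A B T"
  "lhom_pr1 A S B (rhom_thc T) = rhom_pr1 S A B T"
  "lhom_pr2 A S B (rhom_thc T) = rhom_pr2 S A B T"
  "lhom_pair A S B (rhom_thc T) = rhom_pair S A B T"
  "leibniz_lhom A S B (rhom_thc T) = leibniz_rhom S A B T"
proof -
  show 1: "lhom_pr1 A S B (rhom_thc T) = rhom_pr1 S A B T"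
    "lhom_pr2 A S B (rhom_thc T) = rhom_pr2 S A B T"
    "lhom_pair A S B (rhom_thc T) = rhom_pair S A B T"
    by (intro ext, simp add: lhom_pr1_def rhom_pr1_def lhom_pr2_def rhom_pr2_def lhom_pair_def
        rhom_pair_def lhom_cospan1_def rhom_cospan1_def lhom_cospan2_def rhom_cospan2_def)+
  show 2: "leibniz_lhom_obj A S B (rhom_thc T) = leibniz_rhom_obj S A B T"
    by (intro ext) (simp add: 1 leibniz_lhom_obj_def leibniz_rhom_obj_def)
  show "leibniz_lhom A S B (rhom_thc T) = leibniz_rhom S A B T"
    by (simp add: leibniz_lhom_def leibniz_rhom_def 1 2)
qed

text \<open>The legs correspond in order: in both definitions the first one has the identity in the
  \<open>S\<close>-variable. Only squares of \<open>A\<close> and \<open>B\<close> are flipped,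
  because these two categories are replaced by their opposites while \<open>S\<close> is
  kept.\<close>

lemma leibniz_tensor_thc:
  "leibniz_lhom_obj S (op_cat B) (op_cat A) (tensor_thc T) u f = leibniz_tensor_obj S A B T f u"
  "lhom_pr1 S (op_cat B) (op_cat A) (tensor_thc T) u f = tensor_in1 S A B T f u"
  "lhom_pr2 S (op_cat B) (op_cat A) (tensor_thc T) u f = tensor_in2 S A B T f u"
  "lhom_pair S (op_cat B) (op_cat A) (tensor_thc T) u f = tensor_copair S A B T f u"
  "amap (leibniz_lhom S (op_cat B) (op_cat A) (tensor_thc T)) (\<tau>, flip_square \<sigma>) =
    flip_square (amap (leibniz_tensor S A B T) (\<sigma>, \<tau>))"
proof -
  show 1: "lhom_pr1 S (op_cat B) (op_cat A) (tensor_thc T) u f = tensor_in1 S A B T f u"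
    "lhom_pr2 S (op_cat B) (op_cat A) (tensor_thc T) u f = tensor_in2 S A B T f u"
    "lhom_pair S (op_cat B) (op_cat A) (tensor_thc T) u f = tensor_copair S A B T f u" for u f
    by (simp_all add: fun_eq_iff lhom_pr1_def tensor_in1_def lhom_pr2_def tensor_in2_def lhom_pair_def
        tensor_copair_def lhom_cospan1_def tensor_span1_def lhom_cospan2_def tensor_span2_def
        pullback_op_cat)
  show 2: "leibniz_lhom_obj S (op_cat B) (op_cat A) (tensor_thc T) u f = leibniz_tensor_obj S A B T f u"
    for u f
    by (simp add: 1 leibniz_lhom_obj_def leibniz_tensor_obj_def)
  show "amap (leibniz_lhom S (op_cat B) (op_cat A) (tensor_thc T)) (\<tau>, flip_square \<sigma>) =
    flip_square (amap (leibniz_tensor S A B T) (\<sigma>, \<tau>))"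
    by (simp add: leibniz_lhom_def leibniz_tensor_def Let_def 1 2)
qed

text \<open>Splits the transport of triples into a bijection between products of hom-sets and an
  equivalence of the equations.\<close>

lemma bij_betw_Collect:
  assumes "bij_betw m U V" and "\<And>x. x \<in> U \<Longrightarrow> P x \<longleftrightarrow> Q (m x)"
  shows "bij_betw m {x \<in> U. P x} {y \<in> V. Q y}"
  using assms unfolding bij_betw_def inj_on_def by auto

text \<open>The two reorderings are those of \<open>phi_components\<close> and
  \<open>psi_components\<close>.\<close>

lemma bij_betw_triple:
  assumes "bij_betw p X X'" "bij_betw q Y Y'" "bij_betw r Z Z'"
  shows "bij_betw (\<lambda>(x, y, z). (r z, q y, p x)) (X \<times> Y \<times> Z) (Z' \<times> Y' \<times> X')"
    and "bij_betw (\<lambda>(x, y, z). (q y, p x, r z)) (X \<times> Y \<times> Z) (Y' \<times> X' \<times> Z')"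
  using assms unfolding bij_betw_def by (force simp: inj_on_def image_iff)+

locale leibniz_setting = thc_situation S A B T
  for S :: "('so, 'sm) cat" and A :: "('ao, 'am) cat" and B :: "('bo, 'bm) cat"
    and T :: "('so, 'sm, 'ao, 'am, 'bo, 'bm) thc" +
  assumes pullbacks: "has_pullbacks S" "has_pullbacks A" "has_pullbacks (op_cat B)"
begin

interpretation L: leibniz_corner S A B T
  by unfold_locales (use lhom_functor pullbacks in auto)

interpretation R: leibniz_corner A S B "rhom_thc T"
  by unfold_locales (use rhom_functor pullbacks in auto)

interpretation D: leibniz_corner S "op_cat B" "op_cat A" "tensor_thc T"
proof (intro leibniz_corner.intro leibniz_corner_axioms.intro
    S.category_axioms A.category_op_cat B.category_op_cat)
  show "is_functor (prod_cat (op_cat S) (op_cat A)) (op_cat B) (lhom (tensor_thc T))"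
    using tensor_functor unfolding is_functor_def by force
qed (use pullbacks in auto)

interpretation arrS: category "arrow_cat S" by (rule S.category_arrow_cat)
interpretation arrA: category "arrow_cat A" by (rule A.category_arrow_cat)
interpretation arrB: category "arrow_cat B" by (rule B.category_arrow_cat)

section \<open>The Leibniz tensor as a functor, and squares out of it\<close>

abbreviation Ts :: "'am \<Rightarrow> 'sm \<Rightarrow> 'bm" where "Ts a s \<equiv> amap (tensor T) (a, s)"
abbreviation To :: "'ao \<Rightarrow> 'so \<Rightarrow> 'bo" where "To x z \<equiv> omap (tensor T) (x, z)"
abbreviation tobj :: "'am \<Rightarrow> 'sm \<Rightarrow> 'bm" where "tobj \<equiv> leibniz_tensor_obj S A B T"
abbreviation LT :: "'am square \<Rightarrow> 'sm square \<Rightarrow> 'bm square" where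
  "LT \<sigma> \<tau> \<equiv> amap (leibniz_tensor S A B T) (\<sigma>, \<tau>)"

lemma tensor_arr [simp]:
  assumes "a \<in> Arr A" "s \<in> Arr S"
  shows "Ts a s \<in> Arr B" "Dom B (Ts a s) = To (Dom A a) (Dom S s)" "Cod B (Ts a s) = To (Cod A a) (Cod S s)"
  using D.H_arr[of s a] assms by simp_all

lemma tensor_obj [simp]: "x \<in> Obj A \<Longrightarrow> z \<in> Obj S \<Longrightarrow> To x z \<in> Obj B"
  using D.Ho_obj by simp

lemma tobj_arr [simp]:
  "f \<in> Arr A \<Longrightarrow> u \<in> Arr S \<Longrightarrow> tobj f u \<in> Arr B"
  using D.obj_arr[of u f] by (simp add: leibniz_tensor_thc)

lemma LT_hom:
  assumes "\<sigma> \<in> hom (arrow_cat A) f f'" "\<tau> \<in> hom (arrow_cat S) u u'"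
  shows "LT \<sigma> \<tau> \<in> hom (arrow_cat B) (tobj f u) (tobj f' u')"
  using D.L_hom[OF assms(2), of "flip_square \<sigma>" f' f] assms(1)
  by (simp add: A.flip_square_hom B.flip_square_hom leibniz_tensor_thc)

lemma flip_comp:
  "flip_square (k \<cdot>\<^bsub>arrow_cat C\<^esub> h) = flip_square h \<cdot>\<^bsub>arrow_cat (op_cat C)\<^esub> flip_square k"
  by simp

text \<open>Obtained from \<open>D.leibniz_lhom_functor\<close> by flipping. Direction is reversed
  in both variables, by \<open>op_cat\<close> for squares of \<open>S\<close> and by the flip for
  squares of \<open>A\<close>, and again in the target, so the result is covariant.\<close>

lemma leibniz_tensor_functor:
  "is_functor (prod_cat (arrow_cat A) (arrow_cat S)) (arrow_cat B) (leibniz_tensor S A B T)"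
proof -
  let ?D = "leibniz_lhom S (op_cat B) (op_cat A) (tensor_thc T)"
  have LT: "LT \<sigma> \<tau> = flip_square (amap ?D (\<tau>, flip_square \<sigma>))" for \<sigma> \<tau>
    by (simp add: leibniz_tensor_thc)
  have omap: "omap (leibniz_tensor S A B T) (f, u) = tobj f u" for f u
    by (simp add: leibniz_tensor_def)
  have D: "is_functor (prod_cat (op_cat (arrow_cat S)) (arrow_cat (op_cat A))) (arrow_cat (op_cat B)) ?D"
    by (rule D.leibniz_lhom_functor)
  have ident: "LT (Ident (arrow_cat A) f) (Ident (arrow_cat S) u) = Ident (arrow_cat B) (tobj f u)"
    if fu: "f \<in> Arr A" "u \<in> Arr S" for f u
  proof -
    have "(u, f) \<in> Obj (prod_cat (op_cat (arrow_cat S)) (arrow_cat (op_cat A)))" using fu by simp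
    hence "amap ?D (Ident (prod_cat (op_cat (arrow_cat S)) (arrow_cat (op_cat A))) (u, f)) =
        Ident (arrow_cat (op_cat B)) (omap ?D (u, f))"
      using D unfolding is_functor_def by blast
    moreover have "omap ?D (u, f) = tobj f u"
      by (simp add: leibniz_lhom_def leibniz_tensor_thc)
    ultimately show ?thesis by (simp add: LT)
  qed
  have comp: "LT (\<sigma>' \<cdot>\<^bsub>arrow_cat A\<^esub> \<sigma>) (\<tau>' \<cdot>\<^bsub>arrow_cat S\<^esub> \<tau>) = LT \<sigma>' \<tau>' \<cdot>\<^bsub>arrow_cat B\<^esub> LT \<sigma> \<tau>"
    if \<sigma>: "\<sigma> \<in> Arr (arrow_cat A)" "\<sigma>' \<in> Arr (arrow_cat A)" "sq_tgt \<sigma> = sq_src \<sigma>'"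
      and \<tau>: "\<tau> \<in> Arr (arrow_cat S)" "\<tau>' \<in> Arr (arrow_cat S)" "sq_tgt \<tau> = sq_src \<tau>'"
    for \<sigma> \<sigma>' \<tau> \<tau>'
  proof -
    let ?P = "prod_cat (op_cat (arrow_cat S)) (arrow_cat (op_cat A))"
    have "(\<tau>', flip_square \<sigma>') \<in> Arr ?P" "(\<tau>, flip_square \<sigma>) \<in> Arr ?P"
      "Cod ?P (\<tau>', flip_square \<sigma>') = Dom ?P (\<tau>, flip_square \<sigma>)"
      using \<sigma> \<tau> by (simp_all add: arrow_cat_arr_iff A.flip_square_hom)
    hence "amap ?D ((\<tau>, flip_square \<sigma>) \<cdot>\<^bsub>?P\<^esub> (\<tau>', flip_square \<sigma>')) =
        amap ?D (\<tau>, flip_square \<sigma>) \<cdot>\<^bsub>arrow_cat (op_cat B)\<^esub> amap ?D (\<tau>', flip_square \<sigma>')"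
      using D unfolding is_functor_def by blast
    hence "amap ?D (\<tau>' \<cdot>\<^bsub>arrow_cat S\<^esub> \<tau>, flip_square (\<sigma>' \<cdot>\<^bsub>arrow_cat A\<^esub> \<sigma>)) =
        amap ?D (\<tau>, flip_square \<sigma>) \<cdot>\<^bsub>arrow_cat (op_cat B)\<^esub> amap ?D (\<tau>', flip_square \<sigma>')"
      unfolding flip_comp by (simp del: arrow_cat_simps(5))
    thus ?thesis
      unfolding LT flip_comp by (simp only: LT) simp
  qed
  show ?thesis
    unfolding is_functor_def
    using LT_hom ident comp by (auto simp: omap arrow_cat_arr_iff simp del: arrow_cat_simps(4,5))
qed

text \<open>The bottom edge comes first because it is the top edge of the flipped square, whose
  \<open>D.components\<close> these are.\<close>

definition tensor_components :: "'am \<Rightarrow> 'sm \<Rightarrow> 'bm square \<Rightarrow> 'bm \<times> 'bm \<times> 'bm" where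
  "tensor_components f u h =
     (sq_bot h, sq_top h \<cdot>\<^bsub>B\<^esub> tensor_in1 S A B T f u, sq_top h \<cdot>\<^bsub>B\<^esub> tensor_in2 S A B T f u)"

lemma tensor_components_eq:
  "f \<in> Arr A \<Longrightarrow> u \<in> Arr S \<Longrightarrow> tensor_components f u h = D.components u f (flip_square h)"
  by (simp add: tensor_components_def D.components_def leibniz_tensor_thc)

lemma bij_tensor_components:
  assumes "f \<in> Arr A" "u \<in> Arr S" "g \<in> Arr B"
  shows "bij_betw (tensor_components f u) (hom (arrow_cat B) (tobj f u) g) (D.corner_data u f g)"
proof -
  have "bij_betw flip_square (hom (arrow_cat B) (tobj f u) g) (hom (arrow_cat (op_cat B)) g (tobj f u))"
    by (rule bij_betw_byWitness[where f' = flip_square])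
      (auto simp: B.flip_square_hom, metis B.flip_square_hom flip_square_sel(5))
  moreover have "bij_betw (D.components u f) (hom (arrow_cat (op_cat B)) g (tobj f u)) (D.corner_data u f g)"
    using D.bij_components(1)[of u f g] assms by (simp add: leibniz_tensor_thc)
  ultimately have "bij_betw (D.components u f \<circ> flip_square) (hom (arrow_cat B) (tobj f u) g) (D.corner_data u f g)"
    by (rule bij_betw_trans)
  moreover have "tensor_components f u = D.components u f \<circ> flip_square"
    using assms by (auto simp: tensor_components_eq)
  ultimately show ?thesis by simp
qed

text \<open>Postcomposition in \<open>B\<close> is precomposition after flipping, hence an instance
  of \<open>D.components_comp\<close>.\<close>

lemma tensor_components_post:
  assumes "f \<in> Arr A" "u \<in> Arr S" "h \<in> hom (arrow_cat B) (tobj f u) g" "k \<in> hom (arrow_cat B) g g'"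
  shows "tensor_components f u (k \<cdot>\<^bsub>arrow_cat B\<^esub> h) =
    (case tensor_components f u h of (z, x, y) \<Rightarrow> (sq_bot k \<cdot>\<^bsub>B\<^esub> z, sq_top k \<cdot>\<^bsub>B\<^esub> x, sq_top k \<cdot>\<^bsub>B\<^esub> y))"
  using D.components_comp[of u f "flip_square h" g "flip_square k" g'] assms
  by (simp add: tensor_components_eq B.flip_square_hom leibniz_tensor_thc)

text \<open>After flipping, this is postcomposition with the action of \<open>D\<close> on
  squares.\<close>

lemma tensor_components_pre:
  assumes "\<sigma> \<in> hom (arrow_cat A) f' f" "\<tau> \<in> hom (arrow_cat S) u' u" "h \<in> hom (arrow_cat B) (tobj f u) g"
  shows "tensor_components f' u' (h \<cdot>\<^bsub>arrow_cat B\<^esub> LT \<sigma> \<tau>) =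
    (case tensor_components f u h of (z, x, y) \<Rightarrow> (z \<cdot>\<^bsub>B\<^esub> Ts (sq_bot \<sigma>) (sq_bot \<tau>),
      x \<cdot>\<^bsub>B\<^esub> Ts (sq_bot \<sigma>) (sq_top \<tau>), y \<cdot>\<^bsub>B\<^esub> Ts (sq_top \<sigma>) (sq_bot \<tau>)))"
proof -
  have "f \<in> Arr A" "f' \<in> Arr A" "u \<in> Arr S" "u' \<in> Arr S"
    using assms unfolding A.arrow_cat_hom_iff S.arrow_cat_hom_iff by auto
  thus ?thesis
    using D.components_L_comp[OF assms(2), of "flip_square \<sigma>" f f' "flip_square h" g] assms
    by (simp add: tensor_components_eq A.flip_square_hom B.flip_square_hom leibniz_tensor_thc)
qed


section \<open>Transposition of triples\<close>

definition phi_components :: "'am \<Rightarrow> 'sm \<Rightarrow> 'bm \<Rightarrow> 'bm \<times> 'bm \<times> 'bm \<Rightarrow> 'am \<times> 'am \<times> 'am" where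
  "phi_components f u g = (\<lambda>(z, x, y). (phi T (Dom A f) (Cod S u) (Dom B g) y,
     phi T (Cod A f) (Dom S u) (Dom B g) x, phi T (Cod A f) (Cod S u) (Cod B g) z))"

definition psi_components :: "'am \<Rightarrow> 'sm \<Rightarrow> 'bm \<Rightarrow> 'am \<times> 'am \<times> 'am \<Rightarrow> 'sm \<times> 'sm \<times> 'sm" where
  "psi_components f u g = (\<lambda>(a, x, y). (psi T (Cod A f) (Dom S u) (Dom B g) x,
     psi T (Dom A f) (Cod S u) (Dom B g) a, psi T (Cod A f) (Cod S u) (Cod B g) y))"

context
  fixes f :: 'am and u :: 'sm and g :: 'bm
  assumes fug [simp]: "f \<in> Arr A" "u \<in> Arr S" "g \<in> Arr B"
begin

text \<open>Injectivity lets an equation be recovered from its transpose; without this direction the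
  restricted map could fail to be onto the triples in \<open>A\<close>.\<close>

lemma phi_eq_iff:
  assumes "x \<in> Obj A" "z \<in> Obj S" "y \<in> Obj B" "h \<in> hom B (To x z) y" "h' \<in> hom B (To x z) y"
  shows "phi T x z y h = phi T x z y h' \<longleftrightarrow> h = h'"
  using phi_bij[OF assms(1-3)] assms(4,5) by (auto simp: bij_betw_def inj_on_def)

lemma psi_eq_iff:
  assumes "x \<in> Obj A" "z \<in> Obj S" "y \<in> Obj B" "k \<in> hom A x (L.Ho z y)" "k' \<in> hom A x (L.Ho z y)"
  shows "psi T x z y k = psi T x z y k' \<longleftrightarrow> k = k'"
  using psi_bij[OF assms(1-3)] assms(4,5) by (auto simp: bij_betw_def inj_on_def)

text \<open>Separates the equations from the hom-sets, as \<open>bij_betw_Collect\<close> requires,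
  and spells out composition in the opposite category.\<close>

lemma tensor_data_eq:
  "D.corner_data u f g = {d \<in> hom B (To (Cod A f) (Cod S u)) (Cod B g) \<times>
      hom B (To (Cod A f) (Dom S u)) (Dom B g) \<times> hom B (To (Dom A f) (Cod S u)) (Dom B g).
    case d of (z, x, y) \<Rightarrow> g \<cdot>\<^bsub>B\<^esub> x = z \<cdot>\<^bsub>B\<^esub> Ts (Ident A (Cod A f)) u \<and>
      g \<cdot>\<^bsub>B\<^esub> y = z \<cdot>\<^bsub>B\<^esub> Ts f (Ident S (Cod S u)) \<and>
      x \<cdot>\<^bsub>B\<^esub> Ts f (Ident S (Dom S u)) = y \<cdot>\<^bsub>B\<^esub> Ts (Ident A (Dom A f)) u}"
  by (auto simp: D.corner_data_def)

lemma lhom_data_eq: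
  "L.corner_data u g f = {d \<in> hom A (Dom A f) (L.Ho (Cod S u) (Dom B g)) \<times>
      hom A (Cod A f) (L.Ho (Dom S u) (Dom B g)) \<times> hom A (Cod A f) (L.Ho (Cod S u) (Cod B g)).
    case d of (a, x, y) \<Rightarrow> x \<cdot>\<^bsub>A\<^esub> f = L.H u (Ident B (Dom B g)) \<cdot>\<^bsub>A\<^esub> a \<and>
      y \<cdot>\<^bsub>A\<^esub> f = L.H (Ident S (Cod S u)) g \<cdot>\<^bsub>A\<^esub> a \<and>
      L.H (Ident S (Dom S u)) g \<cdot>\<^bsub>A\<^esub> x = L.H u (Ident B (Cod B g)) \<cdot>\<^bsub>A\<^esub> y}"
  by (auto simp: L.corner_data_def)

lemma rhom_data_eq:
  "R.corner_data f g u = {d \<in> hom S (Dom S u) (R.Ho (Cod A f) (Dom B g)) \<times>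
      hom S (Cod S u) (R.Ho (Dom A f) (Dom B g)) \<times> hom S (Cod S u) (R.Ho (Cod A f) (Cod B g)).
    case d of (a, x, y) \<Rightarrow> x \<cdot>\<^bsub>S\<^esub> u = R.H f (Ident B (Dom B g)) \<cdot>\<^bsub>S\<^esub> a \<and>
      y \<cdot>\<^bsub>S\<^esub> u = R.H (Ident A (Cod A f)) g \<cdot>\<^bsub>S\<^esub> a \<and>
      R.H (Ident A (Dom A f)) g \<cdot>\<^bsub>S\<^esub> x = R.H f (Ident B (Cod B g)) \<cdot>\<^bsub>S\<^esub> y}"
  by (auto simp: R.corner_data_def)

text \<open>Each equation is transposed by naturality in the two variables whose arrows occur in it.
  The order of the equations is reversed, like that of the entries.\<close>

lemma bij_phi_components:
  "bij_betw (phi_components f u g) (D.corner_data u f g) (L.corner_data u g f)"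
  unfolding tensor_data_eq lhom_data_eq
proof (rule bij_betw_Collect)
  show "bij_betw (phi_components f u g)
     (hom B (To (Cod A f) (Cod S u)) (Cod B g) \<times>
      hom B (To (Cod A f) (Dom S u)) (Dom B g) \<times> hom B (To (Dom A f) (Cod S u)) (Dom B g))
     (hom A (Dom A f) (L.Ho (Cod S u) (Dom B g)) \<times>
      hom A (Cod A f) (L.Ho (Dom S u) (Dom B g)) \<times> hom A (Cod A f) (L.Ho (Cod S u) (Cod B g)))"
    unfolding phi_components_def by (intro bij_betw_triple phi_bij) simp_all
next
  fix d assume "d \<in> hom B (To (Cod A f) (Cod S u)) (Cod B g) \<times>
      hom B (To (Cod A f) (Dom S u)) (Dom B g) \<times> hom B (To (Dom A f) (Cod S u)) (Dom B g)"
  then obtain z x y where d: "d = (z, x, y)" and z: "z \<in> hom B (To (Cod A f) (Cod S u)) (Cod B g)"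
    and x: "x \<in> hom B (To (Cod A f) (Dom S u)) (Dom B g)"
    and y: "y \<in> hom B (To (Dom A f) (Cod S u)) (Dom B g)" by auto
  let ?a = "phi T (Dom A f) (Cod S u) (Dom B g) y" and ?x = "phi T (Cod A f) (Dom S u) (Dom B g) x"
    and ?y = "phi T (Cod A f) (Cod S u) (Cod B g) z"
  note arrs = A.arr_hom[OF fug(1)] S.arr_hom[OF fug(2)] B.arr_hom[OF fug(3)]
  \<comment> \<open>Commutativity on the first summand of the pushout becomes compatibility at the
    pullback.\<close>
  have "g \<cdot>\<^bsub>B\<^esub> x = z \<cdot>\<^bsub>B\<^esub> Ts (Ident A (Cod A f)) u \<longleftrightarrow>
      L.H (Ident S (Dom S u)) g \<cdot>\<^bsub>A\<^esub> ?x = L.H u (Ident B (Cod B g)) \<cdot>\<^bsub>A\<^esub> ?y"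
    using x z phi_eq_iff[of "Cod A f" "Dom S u" "Cod B g" "g \<cdot>\<^bsub>B\<^esub> x" "z \<cdot>\<^bsub>B\<^esub> Ts (Ident A (Cod A f)) u"]
      phi_natural_B[OF arrs(3) _ _ _ _ x] phi_natural_S[OF arrs(2) _ _ _ _ z] by (simp add: hom_iff)
  moreover have "g \<cdot>\<^bsub>B\<^esub> y = z \<cdot>\<^bsub>B\<^esub> Ts f (Ident S (Cod S u)) \<longleftrightarrow>
      ?y \<cdot>\<^bsub>A\<^esub> f = L.H (Ident S (Cod S u)) g \<cdot>\<^bsub>A\<^esub> ?a"
    using y z phi_eq_iff[of "Dom A f" "Cod S u" "Cod B g" "g \<cdot>\<^bsub>B\<^esub> y" "z \<cdot>\<^bsub>B\<^esub> Ts f (Ident S (Cod S u))"]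
      phi_natural_B[OF arrs(3) _ _ _ _ y] phi_natural_A[OF arrs(1) _ _ _ _ z] by (auto simp: hom_iff)
  \<comment> \<open>Compatibility at the pushout becomes commutativity seen through the first
    projection.\<close>
  moreover have "x \<cdot>\<^bsub>B\<^esub> Ts f (Ident S (Dom S u)) = y \<cdot>\<^bsub>B\<^esub> Ts (Ident A (Dom A f)) u \<longleftrightarrow>
      ?x \<cdot>\<^bsub>A\<^esub> f = L.H u (Ident B (Dom B g)) \<cdot>\<^bsub>A\<^esub> ?a"
    using x y phi_eq_iff[of "Dom A f" "Dom S u" "Dom B g" "x \<cdot>\<^bsub>B\<^esub> Ts f (Ident S (Dom S u))"
        "y \<cdot>\<^bsub>B\<^esub> Ts (Ident A (Dom A f)) u"]
      phi_natural_A[OF arrs(1) _ _ _ _ x] phi_natural_S[OF arrs(2) _ _ _ _ y] by (simp add: hom_iff)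
  ultimately show "(case d of (z, x, y) \<Rightarrow> g \<cdot>\<^bsub>B\<^esub> x = z \<cdot>\<^bsub>B\<^esub> Ts (Ident A (Cod A f)) u \<and>
      g \<cdot>\<^bsub>B\<^esub> y = z \<cdot>\<^bsub>B\<^esub> Ts f (Ident S (Cod S u)) \<and>
      x \<cdot>\<^bsub>B\<^esub> Ts f (Ident S (Dom S u)) = y \<cdot>\<^bsub>B\<^esub> Ts (Ident A (Dom A f)) u) \<longleftrightarrow>
    (case phi_components f u g d of (a, x, y) \<Rightarrow> x \<cdot>\<^bsub>A\<^esub> f = L.H u (Ident B (Dom B g)) \<cdot>\<^bsub>A\<^esub> a \<and>
      y \<cdot>\<^bsub>A\<^esub> f = L.H (Ident S (Cod S u)) g \<cdot>\<^bsub>A\<^esub> a \<and>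
      L.H (Ident S (Dom S u)) g \<cdot>\<^bsub>A\<^esub> x = L.H u (Ident B (Cod B g)) \<cdot>\<^bsub>A\<^esub> y)"
    unfolding d phi_components_def prod.case by blast
qed

text \<open>The first equation keeps its place and the other two are exchanged: commutativity
  through the second projection and compatibility at the pullback trade roles.\<close>

lemma bij_psi_components:
  "bij_betw (psi_components f u g) (L.corner_data u g f) (R.corner_data f g u)"
  unfolding lhom_data_eq rhom_data_eq
proof (rule bij_betw_Collect)
  show "bij_betw (psi_components f u g)
     (hom A (Dom A f) (L.Ho (Cod S u) (Dom B g)) \<times>
      hom A (Cod A f) (L.Ho (Dom S u) (Dom B g)) \<times> hom A (Cod A f) (L.Ho (Cod S u) (Cod B g)))
     (hom S (Dom S u) (R.Ho (Cod A f) (Dom B g)) \<times>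
      hom S (Cod S u) (R.Ho (Dom A f) (Dom B g)) \<times> hom S (Cod S u) (R.Ho (Cod A f) (Cod B g)))"
    unfolding psi_components_def lhom_rhom_thc by (intro bij_betw_triple psi_bij) simp_all
next
  fix d assume "d \<in> hom A (Dom A f) (L.Ho (Cod S u) (Dom B g)) \<times>
      hom A (Cod A f) (L.Ho (Dom S u) (Dom B g)) \<times> hom A (Cod A f) (L.Ho (Cod S u) (Cod B g))"
  then obtain a x y where d: "d = (a, x, y)" and a: "a \<in> hom A (Dom A f) (L.Ho (Cod S u) (Dom B g))"
    and x: "x \<in> hom A (Cod A f) (L.Ho (Dom S u) (Dom B g))"
    and y: "y \<in> hom A (Cod A f) (L.Ho (Cod S u) (Cod B g))" by auto
  let ?x = "psi T (Dom A f) (Cod S u) (Dom B g) a" and ?a = "psi T (Cod A f) (Dom S u) (Dom B g) x"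
    and ?y = "psi T (Cod A f) (Cod S u) (Cod B g) y"
  note arrs = A.arr_hom[OF fug(1)] S.arr_hom[OF fug(2)] B.arr_hom[OF fug(3)]
  have "x \<cdot>\<^bsub>A\<^esub> f = L.H u (Ident B (Dom B g)) \<cdot>\<^bsub>A\<^esub> a \<longleftrightarrow>
      ?x \<cdot>\<^bsub>S\<^esub> u = R.H f (Ident B (Dom B g)) \<cdot>\<^bsub>S\<^esub> ?a"
    using x a psi_eq_iff[of "Dom A f" "Dom S u" "Dom B g" "x \<cdot>\<^bsub>A\<^esub> f" "L.H u (Ident B (Dom B g)) \<cdot>\<^bsub>A\<^esub> a"]
      psi_natural_A[OF arrs(1) _ _ _ _ x] psi_natural_S[OF arrs(2) _ _ _ _ a] by (auto simp: hom_iff)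
  moreover have "y \<cdot>\<^bsub>A\<^esub> f = L.H (Ident S (Cod S u)) g \<cdot>\<^bsub>A\<^esub> a \<longleftrightarrow>
      R.H (Ident A (Dom A f)) g \<cdot>\<^bsub>S\<^esub> ?x = R.H f (Ident B (Cod B g)) \<cdot>\<^bsub>S\<^esub> ?y"
    using y a psi_eq_iff[of "Dom A f" "Cod S u" "Cod B g" "y \<cdot>\<^bsub>A\<^esub> f" "L.H (Ident S (Cod S u)) g \<cdot>\<^bsub>A\<^esub> a"]
      psi_natural_A[OF arrs(1) _ _ _ _ y] psi_natural_B[OF arrs(3) _ _ _ _ a] by (auto simp: hom_iff)
  moreover have "L.H (Ident S (Dom S u)) g \<cdot>\<^bsub>A\<^esub> x = L.H u (Ident B (Cod B g)) \<cdot>\<^bsub>A\<^esub> y \<longleftrightarrow>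
      ?y \<cdot>\<^bsub>S\<^esub> u = R.H (Ident A (Cod A f)) g \<cdot>\<^bsub>S\<^esub> ?a"
    using x y psi_eq_iff[of "Cod A f" "Dom S u" "Cod B g" "L.H (Ident S (Dom S u)) g \<cdot>\<^bsub>A\<^esub> x"
        "L.H u (Ident B (Cod B g)) \<cdot>\<^bsub>A\<^esub> y"]
      psi_natural_B[OF arrs(3) _ _ _ _ x] psi_natural_S[OF arrs(2) _ _ _ _ y] by (auto simp: hom_iff)
  ultimately show "(case d of (a, x, y) \<Rightarrow> x \<cdot>\<^bsub>A\<^esub> f = L.H u (Ident B (Dom B g)) \<cdot>\<^bsub>A\<^esub> a \<and>
      y \<cdot>\<^bsub>A\<^esub> f = L.H (Ident S (Cod S u)) g \<cdot>\<^bsub>A\<^esub> a \<and>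
      L.H (Ident S (Dom S u)) g \<cdot>\<^bsub>A\<^esub> x = L.H u (Ident B (Cod B g)) \<cdot>\<^bsub>A\<^esub> y) \<longleftrightarrow>
    (case psi_components f u g d of (a, x, y) \<Rightarrow> x \<cdot>\<^bsub>S\<^esub> u = R.H f (Ident B (Dom B g)) \<cdot>\<^bsub>S\<^esub> a \<and>
      y \<cdot>\<^bsub>S\<^esub> u = R.H (Ident A (Cod A f)) g \<cdot>\<^bsub>S\<^esub> a \<and>
      R.H (Ident A (Dom A f)) g \<cdot>\<^bsub>S\<^esub> x = R.H f (Ident B (Cod B g)) \<cdot>\<^bsub>S\<^esub> y)"
    unfolding d psi_components_def prod.case by blast
qed

lemma leibniz_phi_eq:
  "leibniz_phi S A B T f u g = L.square_of u g f \<circ> phi_components f u g \<circ> tensor_components f u"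
  by (simp add: fun_eq_iff leibniz_phi_def L.square_of_def phi_components_def tensor_components_def)

lemma leibniz_psi_eq:
  "leibniz_psi S A B T f u g = R.square_of f g u \<circ> psi_components f u g \<circ> L.components u g"
  by (simp add: fun_eq_iff leibniz_psi_def R.square_of_def psi_components_def L.components_def
      leibniz_rhom_thc)

lemma bij_leibniz_phi:
  "bij_betw (leibniz_phi S A B T f u g) (hom (arrow_cat B) (tobj f u) g) (hom (arrow_cat A) f (L.obj u g))"
  unfolding leibniz_phi_eq
  by (intro bij_betw_trans[OF bij_tensor_components] bij_betw_trans[OF bij_phi_components]
      L.bij_components fug)

lemma bij_leibniz_psi:
  "bij_betw (leibniz_psi S A B T f u g) (hom (arrow_cat A) f (L.obj u g)) (hom (arrow_cat S) u (R.obj f g))"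
  unfolding leibniz_psi_eq
  by (intro bij_betw_trans[OF L.bij_components(1)] bij_betw_trans[OF bij_psi_components]
      R.bij_components fug)

lemma leibniz_phi_hom:
  "h \<in> hom (arrow_cat B) (tobj f u) g \<Longrightarrow> leibniz_phi S A B T f u g h \<in> hom (arrow_cat A) f (L.obj u g)"
  using bij_leibniz_phi bij_betwE by blast

lemma leibniz_psi_hom:
  "k \<in> hom (arrow_cat A) f (L.obj u g) \<Longrightarrow> leibniz_psi S A B T f u g k \<in> hom (arrow_cat S) u (R.obj f g)"
  using bij_leibniz_psi bij_betwE by blast

lemma tensor_components_data:
  "h \<in> hom (arrow_cat B) (tobj f u) g \<Longrightarrow> tensor_components f u h \<in> D.corner_data u f g"
  using bij_betwE[OF bij_tensor_components[OF fug]] by blast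

text \<open>The transposed triple satisfies the equations of the corner, so
  \<open>L.components\<close> undoes \<open>L.square_of\<close>. This removes the induced arrow from
  the naturality computations.\<close>

lemma components_leibniz_phi:
  assumes "h \<in> hom (arrow_cat B) (tobj f u) g"
  shows "L.components u g (leibniz_phi S A B T f u g h) = phi_components f u g (tensor_components f u h)"
proof -
  have "phi_components f u g (tensor_components f u h) \<in> L.corner_data u g f"
    using tensor_components_data[OF assms] bij_betwE[OF bij_phi_components] by blast
  thus ?thesis unfolding leibniz_phi_eq by (simp add: L.square_of_hom)
qed

lemma components_leibniz_psi:
  assumes "k \<in> hom (arrow_cat A) f (L.obj u g)"
  shows "R.components f g (leibniz_psi S A B T f u g k) = psi_components f u g (L.components u g k)"
proof -
  have "psi_components f u g (L.components u g k) \<in> R.corner_data f g u"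
    using L.components_in_data[OF fug(2,3) assms] bij_betwE[OF bij_psi_components] by blast
  thus ?thesis unfolding leibniz_psi_eq by (simp add: R.square_of_hom)
qed

end


section \<open>Naturality of the induced isomorphisms\<close>

lemma tensor_data_cases:
  assumes "f \<in> Arr A" "u \<in> Arr S" "g \<in> Arr B" "h \<in> hom (arrow_cat B) (tobj f u) g"
  obtains z x y where "tensor_components f u h = (z, x, y)" "z \<in> hom B (To (Cod A f) (Cod S u)) (Cod B g)"
    "x \<in> hom B (To (Cod A f) (Dom S u)) (Dom B g)" "y \<in> hom B (To (Dom A f) (Cod S u)) (Dom B g)"
  using tensor_components_data[OF assms] unfolding tensor_data_eq[OF assms(1-3)] by auto

lemma lhom_data_cases:
  assumes "f \<in> Arr A" "u \<in> Arr S" "g \<in> Arr B" "k \<in> hom (arrow_cat A) f (L.obj u g)"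
  obtains a x y where "L.components u g k = (a, x, y)" "a \<in> hom A (Dom A f) (L.Ho (Cod S u) (Dom B g))"
    "x \<in> hom A (Cod A f) (L.Ho (Dom S u) (Dom B g))" "y \<in> hom A (Cod A f) (L.Ho (Cod S u) (Cod B g))"
  using L.components_in_data[OF assms(2-4)] unfolding lhom_data_eq[OF assms(1-3)] by auto

lemma arrow_homD:
  "\<sigma> \<in> hom (arrow_cat A) f f' \<Longrightarrow> f \<in> Arr A \<and> f' \<in> Arr A \<and>
    sq_top \<sigma> \<in> hom A (Dom A f) (Dom A f') \<and> sq_bot \<sigma> \<in> hom A (Cod A f) (Cod A f')"
  "\<tau> \<in> hom (arrow_cat S) u u' \<Longrightarrow> u \<in> Arr S \<and> u' \<in> Arr S \<and>
    sq_top \<tau> \<in> hom S (Dom S u) (Dom S u') \<and> sq_bot \<tau> \<in> hom S (Cod S u) (Cod S u')"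
  "\<rho> \<in> hom (arrow_cat B) g g' \<Longrightarrow> g \<in> Arr B \<and> g' \<in> Arr B \<and>
    sq_top \<rho> \<in> hom B (Dom B g) (Dom B g') \<and> sq_bot \<rho> \<in> hom B (Cod B g) (Cod B g')"
  unfolding A.arrow_cat_hom_iff S.arrow_cat_hom_iff B.arrow_cat_hom_iff by auto

abbreviation LR :: "'am square \<Rightarrow> 'bm square \<Rightarrow> 'sm square" where
  "LR \<sigma> \<rho> \<equiv> amap (leibniz_rhom S A B T) (\<sigma>, \<rho>)"

lemma arrow_ident_hom:
  "f \<in> Arr A \<Longrightarrow> Ident (arrow_cat A) f \<in> hom (arrow_cat A) f f"
  "u \<in> Arr S \<Longrightarrow> Ident (arrow_cat S) u \<in> hom (arrow_cat S) u u"
  "g \<in> Arr B \<Longrightarrow> Ident (arrow_cat B) g \<in> hom (arrow_cat B) g g"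
  by (simp_all add: arrA.ident_hom arrS.ident_hom arrB.ident_hom del: arrow_cat_simps(4))

lemma leibniz_phi_natural_A:
  assumes \<sigma>: "\<sigma> \<in> hom (arrow_cat A) f' f" and u: "u \<in> Arr S" and g: "g \<in> Arr B"
    and h: "h \<in> hom (arrow_cat B) (tobj f u) g"
  shows "leibniz_phi S A B T f' u g (h \<cdot>\<^bsub>arrow_cat B\<^esub> LT \<sigma> (Ident (arrow_cat S) u)) =
    leibniz_phi S A B T f u g h \<cdot>\<^bsub>arrow_cat A\<^esub> \<sigma>"
proof (rule L.square_eqI)
  note \<sigma>' = arrow_homD(1)[OF \<sigma>]
  have f: "f \<in> Arr A" "f' \<in> Arr A" using \<sigma>' by auto
  note id = arrow_ident_hom(2)[OF u]
  note h' = arrB.comp_hom[OF LT_hom[OF \<sigma> id] h]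
  note k = leibniz_phi_hom[OF f(1) u g h]
  show "leibniz_phi S A B T f' u g (h \<cdot>\<^bsub>arrow_cat B\<^esub> LT \<sigma> (Ident (arrow_cat S) u))
      \<in> hom (arrow_cat A) f' (L.obj u g)"
    by (rule leibniz_phi_hom[OF f(2) u g h'])
  show "leibniz_phi S A B T f u g h \<cdot>\<^bsub>arrow_cat A\<^esub> \<sigma> \<in> hom (arrow_cat A) f' (L.obj u g)"
    by (rule arrA.comp_hom[OF \<sigma> k])
  obtain z x y where zxy: "tensor_components f u h = (z, x, y)"
    "z \<in> hom B (To (Cod A f) (Cod S u)) (Cod B g)" "x \<in> hom B (To (Cod A f) (Dom S u)) (Dom B g)"
    "y \<in> hom B (To (Dom A f) (Cod S u)) (Dom B g)"
    by (rule tensor_data_cases[OF f(1) u g h])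
  show "L.components u g (leibniz_phi S A B T f' u g (h \<cdot>\<^bsub>arrow_cat B\<^esub> LT \<sigma> (Ident (arrow_cat S) u))) =
      L.components u g (leibniz_phi S A B T f u g h \<cdot>\<^bsub>arrow_cat A\<^esub> \<sigma>)"
    \<comment> \<open>Both sides are now triples and differ by three uses of
      \<open>phi_natural_A\<close>: with the top edge of \<sigma> for the entry starting at
      \<open>Dom A f\<close>, and with the bottom edge for the two starting at
      \<open>Cod A f\<close>.\<close>
    unfolding components_leibniz_phi[OF f(2) u g h'] tensor_components_pre[OF \<sigma> id h]
      L.components_comp[OF u g k \<sigma>] components_leibniz_phi[OF f(1) u g h] zxy(1)
    using f u g \<sigma>' zxy(2-4) by (simp add: phi_components_def phi_natural_A)
qed (use u g in auto)

lemma leibniz_phi_natural_S: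
  assumes \<tau>: "\<tau> \<in> hom (arrow_cat S) u' u" and f: "f \<in> Arr A" and g: "g \<in> Arr B"
    and h: "h \<in> hom (arrow_cat B) (tobj f u) g"
  shows "leibniz_phi S A B T f u' g (h \<cdot>\<^bsub>arrow_cat B\<^esub> LT (Ident (arrow_cat A) f) \<tau>) =
    L.L \<tau> (Ident (arrow_cat B) g) \<cdot>\<^bsub>arrow_cat A\<^esub> leibniz_phi S A B T f u g h"
proof (rule L.square_eqI)
  note \<tau>' = arrow_homD(2)[OF \<tau>]
  have u: "u \<in> Arr S" "u' \<in> Arr S" using \<tau>' by auto
  note id = arrow_ident_hom(1)[OF f] arrow_ident_hom(3)[OF g]
  note h' = arrB.comp_hom[OF LT_hom[OF id(1) \<tau>] h]
  note k = leibniz_phi_hom[OF f u(1) g h]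
  show "leibniz_phi S A B T f u' g (h \<cdot>\<^bsub>arrow_cat B\<^esub> LT (Ident (arrow_cat A) f) \<tau>)
      \<in> hom (arrow_cat A) f (L.obj u' g)"
    by (rule leibniz_phi_hom[OF f u(2) g h'])
  show "L.L \<tau> (Ident (arrow_cat B) g) \<cdot>\<^bsub>arrow_cat A\<^esub> leibniz_phi S A B T f u g h
      \<in> hom (arrow_cat A) f (L.obj u' g)"
    by (rule arrA.comp_hom[OF k L.L_hom[OF \<tau> id(2)]])
  obtain z x y where zxy: "tensor_components f u h = (z, x, y)"
    "z \<in> hom B (To (Cod A f) (Cod S u)) (Cod B g)" "x \<in> hom B (To (Cod A f) (Dom S u)) (Dom B g)"
    "y \<in> hom B (To (Dom A f) (Cod S u)) (Dom B g)"
    by (rule tensor_data_cases[OF f u(1) g h])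
  show "L.components u' g (leibniz_phi S A B T f u' g (h \<cdot>\<^bsub>arrow_cat B\<^esub> LT (Ident (arrow_cat A) f) \<tau>)) =
      L.components u' g (L.L \<tau> (Ident (arrow_cat B) g) \<cdot>\<^bsub>arrow_cat A\<^esub> leibniz_phi S A B T f u g h)"
    \<comment> \<open>Here the middle entry lies over the domain of \<open>u\<close> and uses the
      top edge of \<tau>; the outer two lie over the codomain.\<close>
    unfolding components_leibniz_phi[OF f u(2) g h'] tensor_components_pre[OF id(1) \<tau> h]
      L.components_L_comp[OF \<tau> id(2) k] components_leibniz_phi[OF f u(1) g h] zxy(1)
    using f u g \<tau>' zxy(2-4) by (simp add: phi_components_def phi_natural_S)
qed (use arrow_homD(2)[OF \<tau>] g in auto)

lemma leibniz_phi_natural_B: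
  assumes \<rho>: "\<rho> \<in> hom (arrow_cat B) g g'" and f: "f \<in> Arr A" and u: "u \<in> Arr S"
    and h: "h \<in> hom (arrow_cat B) (tobj f u) g"
  shows "leibniz_phi S A B T f u g' (\<rho> \<cdot>\<^bsub>arrow_cat B\<^esub> h) =
    L.L (Ident (arrow_cat S) u) \<rho> \<cdot>\<^bsub>arrow_cat A\<^esub> leibniz_phi S A B T f u g h"
proof (rule L.square_eqI)
  note \<rho>' = arrow_homD(3)[OF \<rho>]
  have g: "g \<in> Arr B" "g' \<in> Arr B" using \<rho>' by auto
  note id = arrow_ident_hom(2)[OF u]
  note h' = arrB.comp_hom[OF h \<rho>]
  note k = leibniz_phi_hom[OF f u g(1) h]
  show "leibniz_phi S A B T f u g' (\<rho> \<cdot>\<^bsub>arrow_cat B\<^esub> h) \<in> hom (arrow_cat A) f (L.obj u g')"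
    by (rule leibniz_phi_hom[OF f u g(2) h'])
  show "L.L (Ident (arrow_cat S) u) \<rho> \<cdot>\<^bsub>arrow_cat A\<^esub> leibniz_phi S A B T f u g h
      \<in> hom (arrow_cat A) f (L.obj u g')"
    by (rule arrA.comp_hom[OF k L.L_hom[OF id \<rho>]])
  obtain z x y where zxy: "tensor_components f u h = (z, x, y)"
    "z \<in> hom B (To (Cod A f) (Cod S u)) (Cod B g)" "x \<in> hom B (To (Cod A f) (Dom S u)) (Dom B g)"
    "y \<in> hom B (To (Dom A f) (Cod S u)) (Dom B g)"
    by (rule tensor_data_cases[OF f u g(1) h])
  show "L.components u g' (leibniz_phi S A B T f u g' (\<rho> \<cdot>\<^bsub>arrow_cat B\<^esub> h)) =
      L.components u g' (L.L (Ident (arrow_cat S) u) \<rho> \<cdot>\<^bsub>arrow_cat A\<^esub> leibniz_phi S A B T f u g h)"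
    \<comment> \<open>The entries with values at the domain of \<open>g\<close> use the top edge of
      \<rho>, the one at the codomain its bottom edge.\<close>
    unfolding components_leibniz_phi[OF f u g(2) h'] tensor_components_post[OF f u h \<rho>]
      L.components_L_comp[OF id \<rho> k] components_leibniz_phi[OF f u g(1) h] zxy(1)
    using f u g \<rho>' zxy(2-4) by (simp add: phi_components_def phi_natural_B)
qed (use arrow_homD(3)[OF \<rho>] u in auto)

lemma leibniz_psi_natural_A:
  assumes \<sigma>: "\<sigma> \<in> hom (arrow_cat A) f' f" and u: "u \<in> Arr S" and g: "g \<in> Arr B"
    and k: "k \<in> hom (arrow_cat A) f (L.obj u g)"
  shows "leibniz_psi S A B T f' u g (k \<cdot>\<^bsub>arrow_cat A\<^esub> \<sigma>) =
    LR \<sigma> (Ident (arrow_cat B) g) \<cdot>\<^bsub>arrow_cat S\<^esub> leibniz_psi S A B T f u g k"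
proof (rule R.square_eqI)
  note \<sigma>' = arrow_homD(1)[OF \<sigma>]
  have f: "f \<in> Arr A" "f' \<in> Arr A" using \<sigma>' by auto
  note id = arrow_ident_hom(3)[OF g]
  note k' = arrA.comp_hom[OF \<sigma> k]
  note l = leibniz_psi_hom[OF f(1) u g k]
  show "leibniz_psi S A B T f' u g (k \<cdot>\<^bsub>arrow_cat A\<^esub> \<sigma>) \<in> hom (arrow_cat S) u (R.obj f' g)"
    by (rule leibniz_psi_hom[OF f(2) u g k'])
  show "LR \<sigma> (Ident (arrow_cat B) g) \<cdot>\<^bsub>arrow_cat S\<^esub> leibniz_psi S A B T f u g k
      \<in> hom (arrow_cat S) u (R.obj f' g)"
    using arrS.comp_hom[OF l R.L_hom[OF \<sigma> id]] by (simp only: leibniz_rhom_thc)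
  obtain a x y where axy: "L.components u g k = (a, x, y)" "a \<in> hom A (Dom A f) (L.Ho (Cod S u) (Dom B g))"
    "x \<in> hom A (Cod A f) (L.Ho (Dom S u) (Dom B g))" "y \<in> hom A (Cod A f) (L.Ho (Cod S u) (Cod B g))"
    by (rule lhom_data_cases[OF f(1) u g k])
  show "R.components f' g (leibniz_psi S A B T f' u g (k \<cdot>\<^bsub>arrow_cat A\<^esub> \<sigma>)) =
      R.components f' g (LR \<sigma> (Ident (arrow_cat B) g) \<cdot>\<^bsub>arrow_cat S\<^esub> leibniz_psi S A B T f u g k)"
    \<comment> \<open>Facts from \<open>R\<close> speak of the construction for
      \<open>rhom_thc T\<close>; \<open>leibniz_rhom_thc(5)\<close> identifies its action with that
      of \<open>leibniz_rhom\<close>.\<close>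
    unfolding components_leibniz_psi[OF f(2) u g k'] L.components_comp[OF u g k \<sigma>]
      R.components_L_comp[OF \<sigma> id l, unfolded leibniz_rhom_thc(5)]
      components_leibniz_psi[OF f(1) u g k] axy(1)
    using f u g \<sigma>' axy(2-4) by (simp add: psi_components_def psi_natural_A)
qed (use arrow_homD(1)[OF \<sigma>] g in auto)

lemma leibniz_psi_natural_S:
  assumes \<tau>: "\<tau> \<in> hom (arrow_cat S) u' u" and f: "f \<in> Arr A" and g: "g \<in> Arr B"
    and k: "k \<in> hom (arrow_cat A) f (L.obj u g)"
  shows "leibniz_psi S A B T f u' g (L.L \<tau> (Ident (arrow_cat B) g) \<cdot>\<^bsub>arrow_cat A\<^esub> k) =
    leibniz_psi S A B T f u g k \<cdot>\<^bsub>arrow_cat S\<^esub> \<tau>"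
proof (rule R.square_eqI)
  note \<tau>' = arrow_homD(2)[OF \<tau>]
  have u: "u \<in> Arr S" "u' \<in> Arr S" using \<tau>' by auto
  note id = arrow_ident_hom(3)[OF g]
  note k' = arrA.comp_hom[OF k L.L_hom[OF \<tau> id]]
  note l = leibniz_psi_hom[OF f u(1) g k]
  show "leibniz_psi S A B T f u' g (L.L \<tau> (Ident (arrow_cat B) g) \<cdot>\<^bsub>arrow_cat A\<^esub> k)
      \<in> hom (arrow_cat S) u' (R.obj f g)"
    by (rule leibniz_psi_hom[OF f u(2) g k'])
  show "leibniz_psi S A B T f u g k \<cdot>\<^bsub>arrow_cat S\<^esub> \<tau> \<in> hom (arrow_cat S) u' (R.obj f g)"
    by (rule arrS.comp_hom[OF \<tau> l])
  obtain a x y where axy: "L.components u g k = (a, x, y)" "a \<in> hom A (Dom A f) (L.Ho (Cod S u) (Dom B g))"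
    "x \<in> hom A (Cod A f) (L.Ho (Dom S u) (Dom B g))" "y \<in> hom A (Cod A f) (L.Ho (Cod S u) (Cod B g))"
    by (rule lhom_data_cases[OF f u(1) g k])
  show "R.components f g (leibniz_psi S A B T f u' g (L.L \<tau> (Ident (arrow_cat B) g) \<cdot>\<^bsub>arrow_cat A\<^esub> k)) =
      R.components f g (leibniz_psi S A B T f u g k \<cdot>\<^bsub>arrow_cat S\<^esub> \<tau>)"
    unfolding components_leibniz_psi[OF f u(2) g k'] L.components_L_comp[OF \<tau> id k]
      R.components_comp[OF f g l \<tau>] components_leibniz_psi[OF f u(1) g k] axy(1)
    using f u g \<tau>' axy(2-4) by (simp add: psi_components_def psi_natural_S)
qed (use f g in auto)

lemma leibniz_psi_natural_B:
  assumes \<rho>: "\<rho> \<in> hom (arrow_cat B) g g'" and f: "f \<in> Arr A" and u: "u \<in> Arr S"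
    and k: "k \<in> hom (arrow_cat A) f (L.obj u g)"
  shows "leibniz_psi S A B T f u g' (L.L (Ident (arrow_cat S) u) \<rho> \<cdot>\<^bsub>arrow_cat A\<^esub> k) =
    LR (Ident (arrow_cat A) f) \<rho> \<cdot>\<^bsub>arrow_cat S\<^esub> leibniz_psi S A B T f u g k"
proof (rule R.square_eqI)
  note \<rho>' = arrow_homD(3)[OF \<rho>]
  have g: "g \<in> Arr B" "g' \<in> Arr B" using \<rho>' by auto
  note id = arrow_ident_hom(2)[OF u] arrow_ident_hom(1)[OF f]
  note k' = arrA.comp_hom[OF k L.L_hom[OF id(1) \<rho>]]
  note l = leibniz_psi_hom[OF f u g(1) k]
  show "leibniz_psi S A B T f u g' (L.L (Ident (arrow_cat S) u) \<rho> \<cdot>\<^bsub>arrow_cat A\<^esub> k)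
      \<in> hom (arrow_cat S) u (R.obj f g')"
    by (rule leibniz_psi_hom[OF f u g(2) k'])
  show "LR (Ident (arrow_cat A) f) \<rho> \<cdot>\<^bsub>arrow_cat S\<^esub> leibniz_psi S A B T f u g k
      \<in> hom (arrow_cat S) u (R.obj f g')"
    using arrS.comp_hom[OF l R.L_hom[OF id(2) \<rho>]] by (simp only: leibniz_rhom_thc)
  obtain a x y where axy: "L.components u g k = (a, x, y)" "a \<in> hom A (Dom A f) (L.Ho (Cod S u) (Dom B g))"
    "x \<in> hom A (Cod A f) (L.Ho (Dom S u) (Dom B g))" "y \<in> hom A (Cod A f) (L.Ho (Cod S u) (Cod B g))"
    by (rule lhom_data_cases[OF f u g(1) k])
  show "R.components f g' (leibniz_psi S A B T f u g' (L.L (Ident (arrow_cat S) u) \<rho> \<cdot>\<^bsub>arrow_cat A\<^esub> k)) =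
      R.components f g' (LR (Ident (arrow_cat A) f) \<rho> \<cdot>\<^bsub>arrow_cat S\<^esub> leibniz_psi S A B T f u g k)"
    unfolding components_leibniz_psi[OF f u g(2) k'] L.components_L_comp[OF id(1) \<rho> k]
      R.components_L_comp[OF id(2) \<rho> l, unfolded leibniz_rhom_thc(5)]
      components_leibniz_psi[OF f u g(1) k] axy(1)
    using f u g \<rho>' axy(2-4) by (simp add: psi_components_def psi_natural_B)
qed (use arrow_homD(3)[OF \<rho>] f in auto)

lemma leibniz_thc_simps:
  "tensor (leibniz_thc S A B T) = leibniz_tensor S A B T" "lhom (leibniz_thc S A B T) = leibniz_lhom S A B T"
  "rhom (leibniz_thc S A B T) = leibniz_rhom S A B T" "phi (leibniz_thc S A B T) = leibniz_phi S A B T"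
  "psi (leibniz_thc S A B T) = leibniz_psi S A B T"
  "omap (leibniz_tensor S A B T) (f, u) = tobj f u" "omap (leibniz_lhom S A B T) (u, g) = L.obj u g"
  "omap (leibniz_rhom S A B T) (f, g) = R.obj f g"
  by (simp_all add: leibniz_thc_def leibniz_tensor_def leibniz_lhom_def leibniz_rhom_def leibniz_rhom_thc)

lemma leibniz_thc_situation:
  "thc_situation (arrow_cat S) (arrow_cat A) (arrow_cat B) (leibniz_thc S A B T)"
proof (intro thc_situation.intro thc_situation_axioms.intro)
  \<comment> \<open>Singled out because \<open>R\<close> yields it for \<open>rhom_thc T\<close>;
    after unfolding, the other conditions are the lemmas above as they stand.\<close>
  show "is_functor (prod_cat (op_cat (arrow_cat A)) (arrow_cat B)) (arrow_cat S) (rhom (leibniz_thc S A B T))"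
    using R.leibniz_lhom_functor by (simp only: leibniz_thc_simps leibniz_rhom_thc)
qed (unfold leibniz_thc_simps arrow_cat_simps(1),
    (rule S.category_arrow_cat A.category_arrow_cat B.category_arrow_cat leibniz_tensor_functor
      L.leibniz_lhom_functor bij_leibniz_phi leibniz_phi_natural_A leibniz_phi_natural_S
      leibniz_phi_natural_B bij_leibniz_psi leibniz_psi_natural_A leibniz_psi_natural_S
      leibniz_psi_natural_B; assumption)+)

end

theorem theorem2p6:
  fixes S :: "('so, 'sm) cat" and A :: "('ao, 'am) cat" and B :: "('bo, 'bm) cat"
    and T :: "('so, 'sm, 'ao, 'am, 'bo, 'bm) thc"
  assumes "category S" and "category A" and "category B"
    and "has_finite_colimits B" and "has_finite_limits A" and "has_finite_limits S"
    and "thc_situation S A B T"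
  shows "thc_situation (arrow_cat S) (arrow_cat A) (arrow_cat B) (leibniz_thc S A B T)"
proof -
  have "has_pullbacks S" "has_pullbacks A"
    using assms by (simp_all add: category.has_pullbacks)
  \<comment> \<open>This is where the finite colimits of \<open>B\<close> enter, read as finite
    limits of the opposite category.\<close>
  moreover have "has_pullbacks (op_cat B)"
    using assms by (simp add: category.has_pullbacks category.category_op_cat has_finite_limits_op_cat)
  ultimately have "leibniz_setting S A B T"
    using assms by (simp add: leibniz_setting_def leibniz_setting_axioms_def)
  thus ?thesis by (rule leibniz_setting.leibniz_thc_situation)
qed

end
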